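(* If $X$ is any Banach space (with FDD $E$ in the cases (ii), (iii), (v), (vi)), each of the following indices, as a function of $K\geqslant1$, is submultiplicative, i.e. satisfies $I(CK)\leqslant I(C)I(K)$ for all $C,K\geqslant1$: (i) $I_1(X,\cdot)$, (ii) $I_1(X,E,\cdot)$, (iii) $I_1^a(X,E,\cdot)$, (iv) $J(X,\cdot)$, (v) $J(X,E,\cdot)$, (vi) $J^a(X,E,\cdot)$. Moreover, $\mathcal{SM}_1(X,\cdot)$ and $\mathcal{SJ}(X,\cdot)$ are subadditive, i.e. satisfy $I(CK)\leqslant I(C)+I(K)$ for all $C,K\geqslant1$.
   Context: Trees: a tree is a set of finite sequences (including $\varnothing$) closed under initial segments. $T'$ is $T$ with its maximal members removed, $d^0(T)=T$, $d^{\xi+1}(T)=(d^\xi(T))'$, $d^\xi(T)=\bigcap_{\zeta<\xi}d^\zeta(T)$ for limit $\xi$, $o(T)=\min\{\xi:d^\xi(T)=\varnothing\}$, with $o(T)=\infty$ if no such ordinal exists. Conventions: $\xi<\infty$ for all ordinals $\xi$, and sums and products involving $\infty$ equal $\infty$. Sums and products of ordinals are the usual ordinal operations. An FDD for $X$ is a sequence $E=(E_n)$ of finite dimensional subspaces so that each $x\in X$ is uniquely $x=\sum x_n$ with $x_n\in E_n$; $P^E_nx=x_n$, $\mathrm{supp}_E(x)=\{n:P^E_nx\neq0\}$. $\Sigma(E,X)$ is the set of finite block sequences: finite sequences of non-zero, finitely supported vectors with $\max\mathrm{supp}_E(x_i)<\min\mathrm{supp}_E(x_{i+1})$. $T_1(X,K)$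 is the tree of all finite sequences $(x_i)_{i=1}^n$ in the unit ball $B_X$ with $K^{-1}\leqslant\|\sum_{i=1}^na_ix_i\|\leqslant1$ for all $(a_i)_{i=1}^n$ in the unit sphere of $\ell_1^n$. $W(X,K)$ is the tree of all finite sequences $(x_i)_{i=1}^n$ in $X$ with $\|x_i\|\geqslant1$ for each $i$ and $\|\sum_{i=1}^na_ix_i\|\leqslant K$ for all $(a_i)_{i=1}^n$ in the unit sphere of $\ell_\infty^n$. $T_1(X,E,K)=T_1(X,K)\cap\Sigma(E,X)$, $W(X,E,K)=W(X,K)\cap\Sigma(E,X)$. For a tree $T$ of sequences in $X$, $d_E(T)$ is the set of $(x_i)_{i=1}^n\in T$ for which there exist $(y_i)_{i\in\mathbb{N}}$ with $i\leqslant\min\mathrm{supp}_E(y_i)$ and $(x_1,\ldots,x_n,y_i)\in T$ for all $i$; $d^\xi_E$ is its transfinite iteration (intersections at limits), $o_E(T)=\min\{\xi:d^\xi_E(T)=\varnothing\}$ (or $\infty$). $I_1(X,K)=o(T_1(X,K))$, $I_1(X,E,K)=o(T_1(X,E,K))$, $I^a_1(X,E,K)=o_E(T_1(X,E,K))$, $J(X,K)=o(W(X,K))$, $J(X,E,K)=o(W(X,E,K))$, $J^a(X,E,K)=o_E(W(X,E,K))$. Schreier families: for families $\mathcal{F},\mathcal{G}$ of finite subsets of $\mathbb{N}$, $\mathcal{F}[\mathcal{G}]$ consists of $\varnothing$ and all unions $\bigcup_{i=1}^sE_i$ with non-empty $E_i\in\mathcal{G}$, $\max E_i<\min E_{i+1}$,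 $\{\min E_i\}_{i=1}^s\in\mathcal{F}$. $\mathcal{S}_0=\{E:|E|\leqslant1\}$, $\mathcal{S}=\mathcal{S}_1=\{\varnothing\}\cup\{E:|E|\leqslant\min E\}$, $\mathcal{S}_{\xi+1}=\mathcal{S}[\mathcal{S}_\xi]$; for limit $\xi<\omega_1$, $\mathcal{S}_\xi=\{E:\exists n\leqslant\min E,\ E\in\mathcal{S}_{\xi_n+1}\}$ for a fixed sequence $\xi_n\uparrow\xi$ with $\mathcal{S}_{\xi_n+1}\subset\mathcal{S}_{\xi_{n+1}}$; $\mathcal{S}_{\omega_1}$ is the family of all finite subsets of $\mathbb{N}$. An infinite sequence $(x_n)\subset X$ is a $K$-$\ell_1^\xi$ spreading model if $(x_n)_{n\in E}\in T_1(X,K)$ for each $E\in\mathcal{S}_\xi$, and a $K$-$c_0^\xi$ special sequence if $(x_n)_{n\in E}\in W(X,K)$ for each $E\in\mathcal{S}_\xi$. $\mathcal{SM}_1(X,K)$ (resp. $\mathcal{SJ}(X,K)$) is the minimum $\xi\leqslant\omega_1$ such that $X$ admits no $K$-$\ell_1^\xi$ spreading model (resp. no $K$-$c_0^\xi$ special sequence), and is $\infty$ if there is no such $\xi$. *)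

theory Defs
  imports "HOL-Analysis.Analysis" "HOL-Library.Sublist"
begin

section \<open>Ordinals\<close>

text \<open>
  The ordinals of cardinality at most that of \<open>'a + nat set\<close>, realised as the points of the
  canonical initial well-order of the successor cardinal.  This stock is closed under suprema of
  families indexed by \<open>'a + nat set\<close> (lemma \<open>ordinal_bounded\<close>), hence under sums and
  products; it contains \<open>\<omega>\<^sub>1\<close>; and since \<open>'a list\<close> has cardinality at most that of
  \<open>'a + nat set\<close>, the transfinite derivatives of any set of finite sequences in \<open>'a\<close> become
  stationary at one of these ordinals, so no larger ordinals are ever needed.
\<close>

abbreviation ordinal_wo :: "('a + nat set) set rel" where
  "ordinal_wo \<equiv> cardSuc (card_of (UNIV :: ('a + nat set) set))"

lemma ordinal_base_infinite: "infinite (UNIV :: ('a + nat set) set)"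
  by (metis UNIV_Plus_UNIV finite_Plus_iff Finite_Set.finite_set infinite_UNIV_nat)

lemma ordinal_wo_infinite: "infinite (Field (ordinal_wo :: ('a + nat set) set rel))"
  using ordinal_base_infinite
  unfolding cardSuc_finite[OF card_of_Card_order] Field_card_of .

lemma ordinal_wo_Card_order: "Card_order (ordinal_wo :: ('a + nat set) set rel)"
  by (simp add: cardSuc_Card_order card_of_Card_order)

lemma ordinal_wo_Well_order: "Well_order (ordinal_wo :: ('a + nat set) set rel)"
  by (simp add: cardSuc_Well_order card_of_Card_order)

typedef 'a ordinal = "Field (ordinal_wo :: ('a + nat set) set rel)"
  using ordinal_wo_infinite by (metis all_not_in_conv infinite_imp_nonempty)

instantiation ordinal :: (type) wellorder
begin

definition less_eq_ordinal :: "'a ordinal \<Rightarrow> 'a ordinal \<Rightarrow> bool" where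
  "\<alpha> \<le> \<beta> \<longleftrightarrow> (Rep_ordinal \<alpha>, Rep_ordinal \<beta>) \<in> ordinal_wo"

definition less_ordinal :: "'a ordinal \<Rightarrow> 'a ordinal \<Rightarrow> bool" where
  "\<alpha> < (\<beta> :: 'a ordinal) \<longleftrightarrow> \<alpha> \<le> \<beta> \<and> \<alpha> \<noteq> \<beta>"

instance
proof
  let ?r = "ordinal_wo :: ('a + nat set) set rel"
  have wo: "Well_order ?r" by (rule ordinal_wo_Well_order)
  then have refl: "Refl ?r" and trans: "trans ?r" and antisym: "antisym ?r"
    and total: "Total ?r" and wf: "wf (?r - Id)"
    by (auto simp: well_order_on_def linear_order_on_def partial_order_on_def preorder_on_def)
  fix x y z :: "'a ordinal"
  have antisym': "x = y" if "x \<le> y" "y \<le> x" for x y :: "'a ordinal"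
    using that antisym unfolding less_eq_ordinal_def antisym_def
    by (meson Rep_ordinal_inject)
  show "x < y \<longleftrightarrow> x \<le> y \<and> \<not> y \<le> x"
    using antisym' refl Rep_ordinal[of x] unfolding less_ordinal_def
    by (metis less_eq_ordinal_def refl_onD)
  show "x \<le> x"
    using refl Rep_ordinal[of x] by (simp add: less_eq_ordinal_def refl_on_def)
  show "x \<le> z" if "x \<le> y" "y \<le> z"
    using that trans unfolding less_eq_ordinal_def by (meson transD)
  show "x = y" if "x \<le> y" "y \<le> x"
    using that by (rule antisym')
  show "x \<le> y \<or> y \<le> x"
    using total refl Rep_ordinal[of x] Rep_ordinal[of y]
    unfolding less_eq_ordinal_def total_on_def refl_on_def by metis
  show "P a" if step: "\<And>x. (\<And>y. y < x \<Longrightarrow> P y) \<Longrightarrow> P x" for P and a :: "'a ordinal"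
  proof -
    have "wf (inv_image (?r - Id) Rep_ordinal)" using wf by simp
    then show ?thesis
    proof (induction a rule: wf_induct_rule)
      case (less a)
      show ?case
        by (rule step, rule less)
          (auto simp: less_ordinal_def less_eq_ordinal_def inv_image_def Rep_ordinal_inject)
    qed
  qed
qed

end

lemma ordinal_no_max: "\<exists>\<beta>. \<alpha> < (\<beta> :: 'a ordinal)"
proof -
  obtain b where b: "b \<in> Field (ordinal_wo :: ('a + nat set) set rel)"
    "Rep_ordinal \<alpha> \<noteq> b" "(Rep_ordinal \<alpha>, b) \<in> ordinal_wo"
    using infinite_Card_order_limit[OF ordinal_wo_Card_order ordinal_wo_infinite Rep_ordinal]
    by blast
  then show ?thesis
    by (intro exI[of _ "Abs_ordinal b"])
      (auto simp: less_ordinal_def less_eq_ordinal_def Abs_ordinal_inverse)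
qed

lemma ordinal_bounded:
  fixes f :: "'a + nat set \<Rightarrow> 'a ordinal"
  shows "\<exists>\<beta>. \<forall>i. f i < \<beta>"
proof (rule ccontr)
  let ?r = "ordinal_wo :: ('a + nat set) set rel"
  let ?K = "(Rep_ordinal \<circ> f) ` UNIV"
  assume "\<not> ?thesis"
  then have unb: "\<And>\<beta>. \<exists>i. \<beta> \<le> f i" by (meson not_le)
  have "cofinal ?K ?r"
    unfolding cofinal_def
  proof
    fix a assume a: "a \<in> Field ?r"
    obtain \<beta> where \<beta>: "Abs_ordinal a < \<beta>" using ordinal_no_max by blast
    obtain i where i: "\<beta> \<le> f i" using unb by blast
    have "Abs_ordinal a < f i" using \<beta> i by simp
    then have "a \<noteq> Rep_ordinal (f i) \<and> (a, Rep_ordinal (f i)) \<in> ?r"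
      using a by (auto simp: less_ordinal_def less_eq_ordinal_def Abs_ordinal_inverse
          Rep_ordinal_inverse)
    then show "\<exists>b\<in>?K. a \<noteq> b \<and> (a, b) \<in> ?r" by auto
  qed
  moreover have "?K \<subseteq> Field ?r" using Rep_ordinal by auto
  moreover have "regularCard ?r"
    using ordinal_base_infinite
    by (intro infinite_cardSuc_regularCard card_of_Card_order) (unfold Field_card_of)
  ultimately have eq: "(card_of ?K, ?r) \<in> ordIso" unfolding regularCard_def by blast
  have "(card_of ?K, card_of (UNIV :: ('a + nat set) set)) \<in> ordLeq" by (rule card_of_image)
  moreover have "(card_of (UNIV :: ('a + nat set) set), ?r) \<in> ordLess"
    by (rule cardSuc_greater) (rule card_of_Card_order)
  ultimately show False
    using eq not_ordLess_ordIso ordLeq_ordLess_trans by blast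
qed

instantiation ordinal :: (type) zero
begin
definition zero_ordinal :: "'a ordinal" where "(0 :: 'a ordinal) = (LEAST \<alpha>. True)"
instance ..
end

definition osuc :: "'a ordinal \<Rightarrow> 'a ordinal" where
  "osuc \<alpha> = (LEAST \<beta>. \<alpha> < \<beta>)"

definition olimit :: "'a ordinal \<Rightarrow> bool" where
  "olimit \<xi> \<longleftrightarrow> \<xi> \<noteq> 0 \<and> (\<forall>\<alpha>. \<xi> \<noteq> osuc \<alpha>)"

lemma osuc_greater [simp]: "\<alpha> < osuc \<alpha>"
  unfolding osuc_def using ordinal_no_max by (rule LeastI_ex)

lemma osuc_least: "\<alpha> < \<beta> \<Longrightarrow> osuc \<alpha> \<le> \<beta>"
  unfolding osuc_def by (rule Least_le)

lemma osuc_inject [simp]: "osuc \<alpha> = osuc \<beta> \<longleftrightarrow> \<alpha> = \<beta>"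
  by (metis leD linorder_neqE osuc_greater osuc_least)

lemma zero_ordinal_le [simp]: "(0 :: 'a ordinal) \<le> \<alpha>"
  unfolding zero_ordinal_def by (rule Least_le) simp

lemma osuc_not_zero [simp]: "osuc \<alpha> \<noteq> 0" "0 \<noteq> osuc \<alpha>"
  using osuc_greater[of \<alpha>] zero_ordinal_le[of \<alpha>] by (metis leD)+

lemma ordinal_cases: obtains "\<alpha> = 0" | \<beta> where "\<alpha> = osuc \<beta>" | "olimit \<alpha>"
  unfolding olimit_def by blast

lemma wf_ordinal: "wf {(\<alpha>, \<beta> :: 'a ordinal). \<alpha> < \<beta>}"
  by (rule wf)

lemma not_olimit [simp]: "\<not> olimit 0" "\<not> olimit (osuc \<alpha>)"
  by (auto simp: olimit_def)

lemma osuc_less_olimit: "olimit \<xi> \<Longrightarrow> \<zeta> < \<xi> \<Longrightarrow> osuc \<zeta> < \<xi>"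
  by (metis olimit_def osuc_least order_le_less)

function oadd :: "'a ordinal \<Rightarrow> 'a ordinal \<Rightarrow> 'a ordinal" where
  "oadd \<alpha> 0 = \<alpha>"
| "oadd \<alpha> (osuc \<beta>) = osuc (oadd \<alpha> \<beta>)"
| "olimit \<beta> \<Longrightarrow> oadd \<alpha> \<beta> = (LEAST \<gamma>. \<forall>\<delta><\<beta>. oadd \<alpha> \<delta> \<le> \<gamma>)"
  by (auto, metis ordinal_cases)
termination by (relation "inv_image {(\<alpha>, \<beta>). \<alpha> < \<beta>} snd") (auto simp: wf_ordinal)

text \<open>\<open>\<alpha> \<cdot> \<beta>\<close> is \<open>\<beta>\<close> consecutive copies of \<open>\<alpha>\<close>.\<close>

function omult :: "'a ordinal \<Rightarrow> 'a ordinal \<Rightarrow> 'a ordinal" where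
  "omult \<alpha> 0 = 0"
| "omult \<alpha> (osuc \<beta>) = oadd (omult \<alpha> \<beta>) \<alpha>"
| "olimit \<beta> \<Longrightarrow> omult \<alpha> \<beta> = (LEAST \<gamma>. \<forall>\<delta><\<beta>. omult \<alpha> \<delta> \<le> \<gamma>)"
  by (auto, metis ordinal_cases)
termination by (relation "inv_image {(\<alpha>, \<beta>). \<alpha> < \<beta>} snd") (auto simp: wf_ordinal)

definition omega1 :: "'a ordinal" where
  "omega1 = (LEAST \<xi>. uncountable {..<\<xi>})"

lemma uncountable_below_omega1: "uncountable {..<(omega1 :: 'a ordinal)}"
proof -
  let ?r = "ordinal_wo :: ('a + nat set) set rel"
  let ?U = "card_of (UNIV :: ('a + nat set) set)"
  have "(?U, ?r) \<in> ordLess" by (rule cardSuc_greater) (rule card_of_Card_order)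
  then have "(?U, card_of (Field ?r)) \<in> ordLeq"
    by (metis card_of_Field_ordIso ordIso_symmetric ordLess_imp_ordLeq ordLeq_ordIso_trans
        ordinal_wo_Card_order)
  then obtain g :: "'a + nat set \<Rightarrow> ('a + nat set) set"
    where g: "inj g" "range g \<subseteq> Field ?r"
    unfolding card_of_ordLeq[symmetric] by blast
  define f where "f = Abs_ordinal \<circ> g"
  have "inj f"
    unfolding f_def using g by (intro comp_inj_on) (auto simp: inj_on_def Abs_ordinal_inject subset_iff)
  moreover have "uncountable (UNIV :: ('a + nat set) set)"
  proof
    assume "countable (UNIV :: ('a + nat set) set)"
    then have "countable (range (Inr :: nat set \<Rightarrow> 'a + nat set))"
      by (rule countable_subset[rotated]) simp
    then have "countable (UNIV :: nat set set)"
      by (rule countable_image_inj_on) simp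
    then obtain h :: "nat set \<Rightarrow> nat" where "inj h" by (auto elim: countableE)
    then have "range (inv h) = UNIV" by (rule inj_imp_surj_inv)
    then show False using Cantors_theorem[of "UNIV :: nat set"] by auto
  qed
  ultimately have "uncountable (range f)" using countable_image_inj_on by blast
  moreover obtain \<beta> where "\<forall>i. f i < \<beta>" using ordinal_bounded by blast
  ultimately have "uncountable {..<\<beta>}" by (meson countable_subset image_subsetI lessThan_iff)
  then show ?thesis unfolding omega1_def by (rule LeastI)
qed

section \<open>Ordinals together with infinity\<close>

datatype 'a xordinal = Ord "'a ordinal" | Infty

instantiation xordinal :: (type) "{linorder, plus, times}"
begin

fun less_eq_xordinal :: "'a xordinal \<Rightarrow> 'a xordinal \<Rightarrow> bool" where
  "Ord \<alpha> \<le> Ord \<beta> \<longleftrightarrow> \<alpha> \<le> \<beta>"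
| "_ \<le> Infty \<longleftrightarrow> True"
| "Infty \<le> Ord _ \<longleftrightarrow> False"

definition less_xordinal :: "'a xordinal \<Rightarrow> 'a xordinal \<Rightarrow> bool" where
  "(x :: 'a xordinal) < y \<longleftrightarrow> x \<le> y \<and> \<not> y \<le> x"

fun plus_xordinal :: "'a xordinal \<Rightarrow> 'a xordinal \<Rightarrow> 'a xordinal" where
  "Ord \<alpha> + Ord \<beta> = Ord (oadd \<alpha> \<beta>)"
| "_ + _ = Infty"

fun times_xordinal :: "'a xordinal \<Rightarrow> 'a xordinal \<Rightarrow> 'a xordinal" where
  "Ord \<alpha> * Ord \<beta> = Ord (omult \<alpha> \<beta>)"
| "_ * _ = Infty"

instance
proof
  fix x y z :: "'a xordinal"
  show "x < y \<longleftrightarrow> x \<le> y \<and> \<not> y \<le> x" by (rule less_xordinal_def)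
  show "x \<le> x" by (cases x) auto
  show "x \<le> z" if "x \<le> y" "y \<le> z" using that by (cases x; cases y; cases z) auto
  show "x = y" if "x \<le> y" "y \<le> x" using that by (cases x; cases y) auto
  show "x \<le> y \<or> y \<le> x" by (cases x; cases y) auto
qed

end

definition submultiplicative_index :: "(real \<Rightarrow> 'a xordinal) \<Rightarrow> bool" where
  "submultiplicative_index I \<longleftrightarrow> (\<forall>C\<ge>1. \<forall>K\<ge>1. I (C * K) \<le> I C * I K)"

definition subadditive_index :: "(real \<Rightarrow> 'a xordinal) \<Rightarrow> bool" where
  "subadditive_index I \<longleftrightarrow> (\<forall>C\<ge>1. \<forall>K\<ge>1. I (C * K) \<le> I C + I K)"

section \<open>Transfinite derivatives of sets of finite sequences\<close>

function derivative_iter ::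
  "('a list set \<Rightarrow> 'a list set) \<Rightarrow> 'a list set \<Rightarrow> 'a ordinal \<Rightarrow> 'a list set" where
  "derivative_iter d T 0 = T"
| "derivative_iter d T (osuc \<xi>) = d (derivative_iter d T \<xi>)"
| "olimit \<xi> \<Longrightarrow> derivative_iter d T \<xi> = (\<Inter>\<zeta>\<in>{..<\<xi>}. derivative_iter d T \<zeta>)"
  by (auto, metis ordinal_cases)
termination by (relation "inv_image {(\<alpha>, \<beta>). \<alpha> < \<beta>} (snd \<circ> snd)") (auto simp: wf_ordinal)

definition derivative_order :: "('a list set \<Rightarrow> 'a list set) \<Rightarrow> 'a list set \<Rightarrow> 'a xordinal" where
  "derivative_order d T =
     (if \<exists>\<xi>. derivative_iter d T \<xi> = {} then Ord (LEAST \<xi>. derivative_iter d T \<xi> = {}) else Infty)"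

definition tree_derivative :: "'a list set \<Rightarrow> 'a list set" where
  "tree_derivative T = T - {t \<in> T. \<forall>s\<in>T. \<not> strict_prefix t s}"

section \<open>Banach spaces and finite-dimensional decompositions\<close>

text \<open>
  Scalar multiplication of a Banach space over the scalar field \<open>'k\<close>.  By the theorem of
  Gelfand and Mazur the only instances of \<^class>\<open>real_normed_field\<close> are, up to isomorphism,
  the real and the complex numbers; for real scalars \<open>smul\<close> is necessarily \<^const>\<open>scaleR\<close>.
\<close>

locale banach_space = vector_space smul
  for smul :: "'k::real_normed_field \<Rightarrow> 'a::banach \<Rightarrow> 'a" +
  assumes norm_smul: "norm (smul c x) = norm c * norm x"
    and smul_of_real: "smul (of_real r) x = r *\<^sub>R x"

text \<open>
  The spaces of a decomposition are indexed from \<open>0\<close>.  Moving the first index from \<open>1\<close> to \<open>0\<close>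
  shifts supports and does not affect the notions below.
\<close>

definition is_fdd :: "('k::real_normed_field \<Rightarrow> 'a::banach \<Rightarrow> 'a) \<Rightarrow> (nat \<Rightarrow> 'a set) \<Rightarrow> bool" where
  "is_fdd smul E \<longleftrightarrow>
     (\<forall>n. module.subspace smul (E n) \<and> (\<exists>B. finite B \<and> module.span smul B = E n)) \<and>
     (\<forall>x. \<exists>!f. (\<forall>n. f n \<in> E n) \<and> f sums x)"

definition fdd_proj :: "(nat \<Rightarrow> 'a::banach set) \<Rightarrow> nat \<Rightarrow> 'a \<Rightarrow> 'a" where
  "fdd_proj E n x = (THE f. (\<forall>m. f m \<in> E m) \<and> f sums x) n"

definition fdd_supp :: "(nat \<Rightarrow> 'a::banach set) \<Rightarrow> 'a \<Rightarrow> nat set" where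
  "fdd_supp E x = {n. fdd_proj E n x \<noteq> 0}"

definition block_seqs :: "(nat \<Rightarrow> 'a::banach set) \<Rightarrow> 'a list set" where
  "block_seqs E =
     {xs. (\<forall>x\<in>set xs. x \<noteq> 0 \<and> finite (fdd_supp E x)) \<and>
          (\<forall>i. Suc i < length xs \<longrightarrow> Max (fdd_supp E (xs ! i)) < Min (fdd_supp E (xs ! Suc i)))}"

definition fdd_derivative :: "(nat \<Rightarrow> 'a::banach set) \<Rightarrow> 'a list set \<Rightarrow> 'a list set" where
  "fdd_derivative E T =
     {xs \<in> T. \<exists>y :: nat \<Rightarrow> 'a. \<forall>i. i \<le> Inf (fdd_supp E (y i)) \<and> xs @ [y i] \<in> T}"

section \<open>The trees and the indices\<close>

definition T1 :: "('k::real_normed_field \<Rightarrow> 'a::banach \<Rightarrow> 'a) \<Rightarrow> real \<Rightarrow> 'a list set" where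
  "T1 smul K =
     {xs. (\<forall>x\<in>set xs. norm x \<le> 1) \<and>
          (\<forall>a. (\<Sum>i<length xs. norm (a i)) = 1 \<longrightarrow>
               inverse K \<le> norm (\<Sum>i<length xs. smul (a i) (xs ! i)) \<and>
               norm (\<Sum>i<length xs. smul (a i) (xs ! i)) \<le> 1)}"

definition W :: "('k::real_normed_field \<Rightarrow> 'a::banach \<Rightarrow> 'a) \<Rightarrow> real \<Rightarrow> 'a list set" where
  "W smul K =
     {xs. (\<forall>x\<in>set xs. 1 \<le> norm x) \<and>
          (\<forall>a. (\<forall>i<length xs. norm (a i) \<le> 1) \<and> (\<exists>i<length xs. norm (a i) = 1) \<longrightarrow>
               norm (\<Sum>i<length xs. smul (a i) (xs ! i)) \<le> K)}"

definition I1 :: "('k::real_normed_field \<Rightarrow> 'a::banach \<Rightarrow> 'a) \<Rightarrow> real \<Rightarrow> 'a xordinal" where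
  "I1 smul K = derivative_order tree_derivative (T1 smul K)"

definition I1_fdd ::
  "('k::real_normed_field \<Rightarrow> 'a::banach \<Rightarrow> 'a) \<Rightarrow> (nat \<Rightarrow> 'a set) \<Rightarrow> real \<Rightarrow> 'a xordinal" where
  "I1_fdd smul E K = derivative_order tree_derivative (T1 smul K \<inter> block_seqs E)"

definition I1_asymp ::
  "('k::real_normed_field \<Rightarrow> 'a::banach \<Rightarrow> 'a) \<Rightarrow> (nat \<Rightarrow> 'a set) \<Rightarrow> real \<Rightarrow> 'a xordinal" where
  "I1_asymp smul E K = derivative_order (fdd_derivative E) (T1 smul K \<inter> block_seqs E)"

definition J :: "('k::real_normed_field \<Rightarrow> 'a::banach \<Rightarrow> 'a) \<Rightarrow> real \<Rightarrow> 'a xordinal" where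
  "J smul K = derivative_order tree_derivative (W smul K)"

definition J_fdd ::
  "('k::real_normed_field \<Rightarrow> 'a::banach \<Rightarrow> 'a) \<Rightarrow> (nat \<Rightarrow> 'a set) \<Rightarrow> real \<Rightarrow> 'a xordinal" where
  "J_fdd smul E K = derivative_order tree_derivative (W smul K \<inter> block_seqs E)"

definition J_asymp ::
  "('k::real_normed_field \<Rightarrow> 'a::banach \<Rightarrow> 'a) \<Rightarrow> (nat \<Rightarrow> 'a set) \<Rightarrow> real \<Rightarrow> 'a xordinal" where
  "J_asymp smul E K = derivative_order (fdd_derivative E) (W smul K \<inter> block_seqs E)"

section \<open>Schreier families, spreading models and special sequences\<close>

text \<open>
  In this section the natural numbers start at \<open>1\<close>, as the condition \<open>card E \<le> Min E\<close>
  presupposes: members of the families do not contain \<open>0\<close>, and the entry at \<open>0\<close> of an infinite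
  sequence plays no role.
\<close>

definition family_comp :: "nat set set \<Rightarrow> nat set set \<Rightarrow> nat set set" where
  "family_comp F G =
     insert {} {\<Union>i<s. A i | (s :: nat) (A :: nat \<Rightarrow> nat set).
        (\<forall>i<s. A i \<in> G \<and> A i \<noteq> {}) \<and>
        (\<forall>i. Suc i < s \<longrightarrow> Max (A i) < Min (A (Suc i))) \<and>
        (\<lambda>i. Min (A i)) ` {..<s} \<in> F}"

definition schreier0 :: "nat set set" where
  "schreier0 = {E. finite E \<and> 0 \<notin> E \<and> card E \<le> 1}"

definition schreier1 :: "nat set set" where
  "schreier1 = insert {} {E. finite E \<and> 0 \<notin> E \<and> E \<noteq> {} \<and> card E \<le> Min E}"

text \<open>
  The Schreier families for \<open>\<xi> \<le> \<omega>\<^sub>1\<close> (the values beyond \<open>\<omega>\<^sub>1\<close> are irrelevant), depending on the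
  sequences \<open>q \<xi> 1, q \<xi> 2, \<dots>\<close> chosen for the countable limit ordinals \<open>\<xi>\<close>.  The conjunct
  \<open>q \<xi> n < \<xi>\<close> makes the recursion well-founded and is implied by \<open>schreier_choice q\<close> below.
  The successor equation at \<open>0\<close> gives \<^const>\<open>schreier1\<close>, see \<open>schreier_one\<close>.  The empty set
  belongs to every family.
\<close>

function schreier :: "('a ordinal \<Rightarrow> nat \<Rightarrow> 'a ordinal) \<Rightarrow> 'a ordinal \<Rightarrow> nat set set" where
  "schreier q 0 = schreier0"
| "schreier q (osuc \<xi>) = family_comp schreier1 (schreier q \<xi>)"
| "olimit \<xi> \<Longrightarrow> schreier q \<xi> =
     (if \<xi> < omega1
      then insert {} {E. \<exists>n\<in>{n. 1 \<le> n \<and> n \<le> Min E \<and> q \<xi> n < \<xi>}.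
                           E \<noteq> {} \<and> E \<in> schreier q (osuc (q \<xi> n))}
      else {E. finite E \<and> 0 \<notin> E})"
  by (auto, metis ordinal_cases)
termination
  by (relation "inv_image {(\<alpha>, \<beta>). \<alpha> < \<beta>} snd") (auto simp: wf_ordinal osuc_less_olimit)

lemma schreier_one: "schreier q (osuc 0) = schreier1"
proof (rule set_eqI, rule iffI)
  fix U assume "U \<in> schreier q (osuc 0)"
  then have "U \<in> family_comp schreier1 schreier0" by simp
  then show "U \<in> schreier1"
    unfolding family_comp_def
  proof (elim insertE CollectE exE conjE)
    assume "U = {}"
    then show ?thesis by (simp add: schreier1_def)
  next
    fix s :: nat and A :: "nat \<Rightarrow> nat set"
    assume U: "U = (\<Union>i<s. A i)" and A: "\<forall>i<s. A i \<in> schreier0 \<and> A i \<noteq> {}"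
      and mins: "(\<lambda>i. Min (A i)) ` {..<s} \<in> schreier1"
    have single: "{Min (A i)} = A i" if "i < s" for i
    proof -
      have "finite (A i)" "A i \<noteq> {}" "card (A i) \<le> 1"
        using A that by (auto simp: schreier0_def)
      then have "card (A i) = 1" by (metis card_0_eq le_antisym less_one not_le)
      then obtain m where "A i = {m}" by (rule card_1_singletonE)
      then show ?thesis by simp
    qed
    have "U = (\<Union>i<s. {Min (A i)})"
      unfolding U by (rule SUP_cong) (simp_all add: single)
    also have "\<dots> = (\<lambda>i. Min (A i)) ` {..<s}" by (rule UNION_singleton_eq_range)
    finally show ?thesis using mins by simp
  qed
next
  fix U assume U: "U \<in> schreier1"
  show "U \<in> schreier q (osuc 0)"
  proof (cases "U = {}")
    case True
    then show ?thesis by (simp add: family_comp_def)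
  next
    case False
    then have fin: "finite U" and zero: "0 \<notin> U" using U by (auto simp: schreier1_def)
    define l where "l = sorted_list_of_set U"
    have l: "set l = U" "sorted_wrt (<) l"
      using fin by (auto simp: l_def)
    define A where "A = (\<lambda>i. {l ! i})"
    have nth: "(\<lambda>i. l ! i) ` {..<length l} = U" using l(1) by (auto simp: set_conv_nth)
    have "U = (\<Union>i<length l. A i)" using nth by (auto simp: A_def)
    moreover have "\<forall>i<length l. A i \<in> schreier0 \<and> A i \<noteq> {}"
      using nth zero by (auto simp: A_def schreier0_def)
    moreover have "\<forall>i. Suc i < length l \<longrightarrow> Max (A i) < Min (A (Suc i))"
      using l(2) by (auto simp: A_def sorted_wrt_iff_nth_less)
    moreover have "(\<lambda>i. Min (A i)) ` {..<length l} \<in> schreier1"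
      using nth U by (simp add: A_def)
    ultimately have "U \<in> family_comp schreier1 schreier0"
      unfolding family_comp_def
      by (intro insertI2 CollectI exI[of _ "length l"] exI[of _ A] conjI)
    then show ?thesis by simp
  qed
qed

definition schreier_choice :: "('a ordinal \<Rightarrow> nat \<Rightarrow> 'a ordinal) \<Rightarrow> bool" where
  "schreier_choice q \<longleftrightarrow>
     (\<forall>\<xi>. olimit \<xi> \<and> \<xi> < omega1 \<longrightarrow>
        strict_mono_on {1..} (q \<xi>) \<and>
        (\<forall>n\<ge>1. q \<xi> n < \<xi>) \<and> (\<forall>\<zeta><\<xi>. \<exists>n\<ge>1. \<zeta> < q \<xi> n) \<and>
        (\<forall>n\<ge>1. schreier q (osuc (q \<xi> n)) \<subseteq> schreier q (q \<xi> (Suc n))))"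

definition subseq_list :: "(nat \<Rightarrow> 'a) \<Rightarrow> nat set \<Rightarrow> 'a list" where
  "subseq_list x E = map x (sorted_list_of_set E)"

definition l1_spreading_model ::
  "('k::real_normed_field \<Rightarrow> 'a::banach \<Rightarrow> 'a) \<Rightarrow> ('a ordinal \<Rightarrow> nat \<Rightarrow> 'a ordinal) \<Rightarrow>
     real \<Rightarrow> 'a ordinal \<Rightarrow> (nat \<Rightarrow> 'a) \<Rightarrow> bool" where
  "l1_spreading_model smul q K \<xi> x \<longleftrightarrow> (\<forall>E\<in>schreier q \<xi>. subseq_list x E \<in> T1 smul K)"

definition c0_special ::
  "('k::real_normed_field \<Rightarrow> 'a::banach \<Rightarrow> 'a) \<Rightarrow> ('a ordinal \<Rightarrow> nat \<Rightarrow> 'a ordinal) \<Rightarrow>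
     real \<Rightarrow> 'a ordinal \<Rightarrow> (nat \<Rightarrow> 'a) \<Rightarrow> bool" where
  "c0_special smul q K \<xi> x \<longleftrightarrow> (\<forall>E\<in>schreier q \<xi>. subseq_list x E \<in> W smul K)"

definition least_upto_omega1 :: "('a ordinal \<Rightarrow> bool) \<Rightarrow> 'a xordinal" where
  "least_upto_omega1 P =
     (if \<exists>\<xi>\<le>omega1. P \<xi> then Ord (LEAST \<xi>. \<xi> \<le> omega1 \<and> P \<xi>) else Infty)"

definition SM1 ::
  "('k::real_normed_field \<Rightarrow> 'a::banach \<Rightarrow> 'a) \<Rightarrow> ('a ordinal \<Rightarrow> nat \<Rightarrow> 'a ordinal) \<Rightarrow>
     real \<Rightarrow> 'a xordinal" where
  "SM1 smul q K = least_upto_omega1 (\<lambda>\<xi>. \<not> (\<exists>x. l1_spreading_model smul q K \<xi> x))"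

definition SJ ::
  "('k::real_normed_field \<Rightarrow> 'a::banach \<Rightarrow> 'a) \<Rightarrow> ('a ordinal \<Rightarrow> nat \<Rightarrow> 'a ordinal) \<Rightarrow>
     real \<Rightarrow> 'a xordinal" where
  "SJ smul q K = least_upto_omega1 (\<lambda>\<xi>. \<not> (\<exists>x. c0_special smul q K \<xi> x))"

end

theory Submission
  imports Defs
begin

text \<open>
  The submultiplicativity statements are a transfinite form of James's blocking argument.  Let
  \<open>T\<close>, \<open>A\<close>, \<open>B\<close> be the trees for the constants \<open>C K\<close>, \<open>C\<close>, \<open>K\<close>.  A member \<open>u\<close> of \<open>T\<close> that
  fails to lie in \<open>A\<close> has a normalised linear combination which, rescaled by \<open>C\<close> (in the
  \<open>\<ell>\<^sub>1\<close> case) or by \<open>1/C\<close> (in the \<open>c\<^sub>0\<close> case), is again an admissible vector \<open>z\<close>, and the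
  concatenation of such blocks turns the constant \<open>C K\<close> into \<open>K\<close>: the sequence of the vectors
  \<open>z\<close> lies in \<open>B\<close>.  If \<open>\<alpha>\<close> is the order of \<open>A\<close>, every node of the \<open>\<alpha>\<close>-th derivative of a subtree
  of \<open>T\<close> must be continued inside that subtree by a segment outside \<open>A\<close>, since otherwise \<open>A\<close>
  would have order greater than \<open>\<alpha>\<close>.  So \<open>\<alpha>\<close> derivatives of \<open>T\<close> pay for one derivative of \<open>B\<close>, and by
  induction on \<open>\<xi>\<close> a sequence of blocks of a node in the derivative of order \<open>\<alpha> \<cdot> \<xi>\<close> of \<open>T\<close> lies in
  the derivative of order \<open>\<xi>\<close> of \<open>B\<close> (\<open>blocks_in_derivative\<close>).  The locale \<open>blocking\<close> isolates
  what is used of the three trees.  The ordinary derivative and the asymptotic one are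
  instances of a single operation \<open>branching_derivative\<close>, and the restriction to block sequences of a
  decomposition is harmless because the vectors \<open>z\<close> are linear combinations of the
  entries of \<open>u\<close> and so have their supports in the union of the supports of these entries.

  Subadditivity uses the same blocks along an infinite sequence.  Suppose that no sequence has all
  its subsequences along sets in \<open>\<S>\<^sub>\<alpha>\<close> in the tree for \<open>C\<close>.  Then every tail of a sequence that is
  good for \<open>C K\<close> contains a set of indices in \<open>\<S>\<^sub>\<alpha>\<close> that carries a block; successive blocks form a
  sequence whose subsequences along sets in \<open>\<S>\<^sub>\<beta>\<close> are blockings of the original one along sets in
  \<open>\<S>\<^sub>\<beta>[\<S>\<^sub>\<alpha>]\<close> (\<open>block_sequence\<close>).  To start from a sequence that is good of order \<open>\<alpha> + \<beta>\<close>, one passes to a subsequence that maps \<open>\<S>\<^sub>\<beta>[\<S>\<^sub>\<alpha>]\<close> into the family of order \<open>\<alpha> + \<beta>\<close>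
  (\<open>schreier_comp_into_oadd\<close>); when \<open>\<alpha> + \<beta>\<close> is uncountable, the family of all finite sets
  serves instead and this is the classical argument of James.
\<close>

section \<open>Ordinal arithmetic\<close>

text \<open>
  A proper initial segment has smaller cardinality than the successor cardinal, so if it is non-empty
  it is an image of the base set, and families indexed by the base set are bounded.  This is what makes the suprema in the limit clauses
  of sum and product exist.
\<close>

lemma ordinal_segment_bounded:
  fixes f :: "'a ordinal \<Rightarrow> 'a ordinal"
  shows "\<exists>\<gamma>. \<forall>\<delta><\<beta>. f \<delta> \<le> \<gamma>"
proof (cases "{..<\<beta>} = {}")
  case True
  then show ?thesis by auto
next
  case False
  let ?r = "ordinal_wo :: ('a + nat set) set rel"
  let ?U = "UNIV :: ('a + nat set) set"
  have sub: "Rep_ordinal ` {..<\<beta>} \<subseteq> underS ?r (Rep_ordinal \<beta>)"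
    by (auto simp: underS_def less_ordinal_def less_eq_ordinal_def Rep_ordinal_inject)
  have "inj_on Rep_ordinal {..<\<beta>}" by (auto simp: inj_on_def Rep_ordinal_inject)
  then have 1: "(card_of {..<\<beta>}, card_of (underS ?r (Rep_ordinal \<beta>))) \<in> ordLeq"
    using sub card_of_ordLeq by blast
  have "(card_of (underS ?r (Rep_ordinal \<beta>)), ?r) \<in> ordLess"
    by (rule card_of_underS[OF ordinal_wo_Card_order Rep_ordinal])
  then have "(card_of (underS ?r (Rep_ordinal \<beta>)), card_of ?U) \<in> ordLeq"
    by (simp add: cardSuc_ordLeq_ordLess card_of_Card_order)
  with 1 have "(card_of {..<\<beta>}, card_of ?U) \<in> ordLeq" by (rule ordLeq_transitive)
  then have "\<exists>h :: 'a + nat set \<Rightarrow> 'a ordinal. h ` UNIV = {..<\<beta>}"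
    by (rule card_of_ordLeq2[OF False, THEN iffD2])
  then obtain h :: "'a + nat set \<Rightarrow> 'a ordinal" where h: "h ` UNIV = {..<\<beta>}" ..
  obtain \<gamma> where \<gamma>: "\<And>i. f (h i) < \<gamma>" using ordinal_bounded[of "f \<circ> h"] by auto
  have "f \<delta> \<le> \<gamma>" if "\<delta> < \<beta>" for \<delta>
  proof -
    have "\<delta> \<in> h ` UNIV" unfolding h using that by simp
    then obtain i where "\<delta> = h i" by blast
    then show ?thesis using \<gamma>[of i] by simp
  qed
  then show ?thesis by blast
qed

lemma less_osuc_iff [simp]: "\<alpha> < osuc \<beta> \<longleftrightarrow> \<alpha> \<le> \<beta>"
  by (meson leD leI order_le_less_trans osuc_greater osuc_least)

lemma ordinal_induct [case_names zero osuc limit]: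
  assumes "P 0" and "\<And>\<xi>. P \<xi> \<Longrightarrow> P (osuc \<xi>)"
    and "\<And>\<xi>. olimit \<xi> \<Longrightarrow> (\<And>\<zeta>. \<zeta> < \<xi> \<Longrightarrow> P \<zeta>) \<Longrightarrow> P \<xi>"
  shows "P \<xi>"
proof (induction \<xi> rule: less_induct)
  case (less \<xi>)
  then show ?case using assms by (cases rule: ordinal_cases[of \<xi>]) auto
qed

lemma oadd_le_limit: "olimit \<beta> \<Longrightarrow> \<delta> < \<beta> \<Longrightarrow> oadd \<alpha> \<delta> \<le> oadd \<alpha> \<beta>"
  using LeastI_ex[OF ordinal_segment_bounded[of \<beta> "oadd \<alpha>"]] by simp

lemma omult_le_limit: "olimit \<beta> \<Longrightarrow> \<delta> < \<beta> \<Longrightarrow> omult \<alpha> \<delta> \<le> omult \<alpha> \<beta>"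
  using LeastI_ex[OF ordinal_segment_bounded[of \<beta> "omult \<alpha>"]] by simp

lemma oadd_strict_mono: "\<delta> < \<beta> \<Longrightarrow> oadd \<alpha> \<delta> < oadd \<alpha> \<beta>"
proof (induction \<beta> rule: ordinal_induct)
  case zero
  then show ?case by (metis leD zero_ordinal_le)
next
  case (osuc \<xi>)
  then show ?case by (auto simp: order_le_less)
next
  case (limit \<xi>)
  have "osuc (oadd \<alpha> \<delta>) \<le> oadd \<alpha> \<xi>"
    using oadd_le_limit[OF limit(1) osuc_less_olimit[OF limit(1,3)]] by simp
  then show ?case by (rule order.strict_trans2[OF osuc_greater])
qed

lemma le_oadd_right: "\<beta> \<le> oadd \<alpha> \<beta>"
proof (induction \<beta> rule: less_induct)
  case (less \<beta>)
  then show ?case using oadd_strict_mono[of "oadd \<alpha> \<beta>" \<beta> \<alpha>] by (meson leD leI)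
qed

section \<open>Transfinite derivatives\<close>

lemma derivative_iter_antimono:
  assumes "\<And>T. d T \<subseteq> T" and "\<xi> \<le> \<zeta>"
  shows "derivative_iter d T \<zeta> \<subseteq> derivative_iter d T \<xi>"
  using assms(2)
proof (induction \<zeta> rule: ordinal_induct)
  case zero
  then have "\<xi> = 0" by (rule order_antisym) simp
  then show ?case by simp
next
  case (osuc \<zeta>)
  then show ?case using assms(1) by (auto simp: order_le_less[of \<xi>])
next
  case (limit \<zeta>)
  then show ?case by (auto simp: order_le_less)
qed

lemma derivative_iter_mono:
  assumes "mono d" and "T \<subseteq> T'"
  shows "derivative_iter d T \<xi> \<subseteq> derivative_iter d T' \<xi>"
proof (induction \<xi> rule: ordinal_induct)
  case (limit \<xi>)
  then show ?case by (auto simp: subset_iff)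
qed (use assms in \<open>auto simp: monoD\<close>)

lemma derivative_iter_oadd_subset:
  assumes "\<And>T. d T \<subseteq> T" and "mono d"
  shows "derivative_iter d T (oadd \<alpha> \<beta>) \<subseteq> derivative_iter d (derivative_iter d T \<alpha>) \<beta>"
proof (induction \<beta> rule: ordinal_induct)
  case (osuc \<xi>)
  then show ?case using assms(2) by (simp add: monoD)
next
  case (limit \<xi>)
  have "derivative_iter d T (oadd \<alpha> \<xi>) \<subseteq> derivative_iter d (derivative_iter d T \<alpha>) \<zeta>"
    if "\<zeta> < \<xi>" for \<zeta>
    using derivative_iter_antimono[OF assms(1) oadd_le_limit[OF limit(1) that]] limit(2)[OF that]
    by (rule order_trans)
  then show ?case unfolding derivative_iter.simps(3)[OF limit(1)] by blast
qed simp

text \<open>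
  The condition \<open>P i\<close> says how far out a continuation has to lie: it is \<^const>\<open>True\<close> for the tree
  derivative of a set closed under initial segments, and \<open>i \<le> min supp\<close> for the derivative along a
  decomposition.
\<close>

definition branching_derivative :: "(nat \<Rightarrow> 'a \<Rightarrow> bool) \<Rightarrow> 'a list set \<Rightarrow> 'a list set" where
  "branching_derivative P T = {xs \<in> T. \<forall>i. \<exists>y. P i y \<and> xs @ [y] \<in> T}"

lemma in_branching_derivative_iff:
  "xs \<in> branching_derivative P T \<longleftrightarrow> xs \<in> T \<and> (\<forall>i. \<exists>y. P i y \<and> xs @ [y] \<in> T)"
  by (simp add: branching_derivative_def)

lemma branching_derivative_subset: "branching_derivative P T \<subseteq> T"
  by (auto simp: branching_derivative_def)

lemma mono_branching_derivative: "mono (branching_derivative P)"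
  unfolding branching_derivative_def by (intro monoI) blast

lemmas branching_iter_antimono =
  derivative_iter_antimono[where d = "branching_derivative P" for P, OF branching_derivative_subset]

lemmas branching_iter_mono =
  derivative_iter_mono[where d = "branching_derivative P" for P, OF mono_branching_derivative]

lemmas branching_iter_oadd_subset =
  derivative_iter_oadd_subset[where d = "branching_derivative P" for P,
    OF branching_derivative_subset mono_branching_derivative]

lemma fdd_derivative_eq:
  "fdd_derivative E = branching_derivative (\<lambda>i y. i \<le> Inf (fdd_supp E y))"
  unfolding fdd_derivative_def branching_derivative_def fun_eq_iff by (simp add: choice_iff)

lemma in_tree_derivative_iff:
  assumes "\<And>xs ys. xs @ ys \<in> T \<Longrightarrow> xs \<in> T"
  shows "xs \<in> tree_derivative T \<longleftrightarrow> xs \<in> T \<and> (\<exists>y. xs @ [y] \<in> T)"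
proof -
  have "(\<exists>s\<in>T. strict_prefix xs s) \<longleftrightarrow> (\<exists>y. xs @ [y] \<in> T)"
  proof
    assume "\<exists>s\<in>T. strict_prefix xs s"
    then obtain y ys where "xs @ y # ys \<in> T" by (auto elim!: strict_prefixE')
    then show "\<exists>y. xs @ [y] \<in> T" using assms[of "xs @ [y]" ys] by auto
  next
    assume "\<exists>y. xs @ [y] \<in> T"
    then obtain y where "xs @ [y] \<in> T" by blast
    moreover have "strict_prefix xs (xs @ [y])" by (simp add: strict_prefix_def)
    ultimately show "\<exists>s\<in>T. strict_prefix xs s" by blast
  qed
  then show ?thesis unfolding tree_derivative_def by blast
qed

text \<open>
  The two derivatives agree only on sets closed under initial segments, so this closure is
  carried along in the induction.
\<close>

lemma derivative_iter_tree_derivative_eq: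
  assumes "\<And>xs ys. xs @ ys \<in> T \<Longrightarrow> xs \<in> T"
  shows "derivative_iter tree_derivative T \<xi> = derivative_iter (branching_derivative (\<lambda>_ _. True)) T \<xi>
    \<and> (\<forall>xs ys. xs @ ys \<in> derivative_iter tree_derivative T \<xi> \<longrightarrow> xs \<in> derivative_iter tree_derivative T \<xi>)"
proof (induction \<xi> rule: ordinal_induct)
  case zero
  then show ?case using assms by auto
next
  case (osuc \<xi>)
  let ?S = "derivative_iter tree_derivative T \<xi>"
  have pre: "xs \<in> ?S" if "xs @ ys \<in> ?S" for xs ys using osuc that by blast
  have iff: "t \<in> tree_derivative ?S \<longleftrightarrow> t \<in> ?S \<and> (\<exists>y. t @ [y] \<in> ?S)" for t
    by (rule in_tree_derivative_iff) (rule pre)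
  then have "tree_derivative ?S = branching_derivative (\<lambda>_ _. True) ?S"
    by (intro set_eqI) (simp add: in_branching_derivative_iff)
  moreover have "xs \<in> tree_derivative ?S" if "xs @ ys \<in> tree_derivative ?S" for xs ys
  proof -
    have "xs @ ys \<in> ?S \<and> (\<exists>y. (xs @ ys) @ [y] \<in> ?S)" using that by (rule iff[THEN iffD1])
    then obtain y where y: "(xs @ ys) @ [y] \<in> ?S" by blast
    obtain z zs where z: "ys @ [y] = z # zs" by (cases "ys @ [y]") auto
    have "xs @ [z] \<in> ?S" by (rule pre[of _ zs]) (use y z in simp)
    moreover have "xs \<in> ?S" by (rule pre) fact
    ultimately show ?thesis unfolding iff by blast
  qed
  ultimately show ?case using osuc by simp
next
  case (limit \<xi>)
  have "xs \<in> derivative_iter tree_derivative T \<zeta>"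
    if "xs @ ys \<in> derivative_iter tree_derivative T \<xi>" "\<zeta> < \<xi>" for xs ys \<zeta>
  proof -
    have "xs @ ys \<in> derivative_iter tree_derivative T \<zeta>" using that limit(1) by simp
    then show ?thesis using limit(2)[OF that(2)] by blast
  qed
  then show ?case using limit by simp
qed

lemma derivative_order_tree_derivative_eq:
  assumes "\<And>xs ys. xs @ ys \<in> T \<Longrightarrow> xs \<in> T"
  shows "derivative_order tree_derivative T = derivative_order (branching_derivative (\<lambda>_ _. True)) T"
  using derivative_iter_tree_derivative_eq[of T] assms by (simp add: derivative_order_def)

text \<open>
  Derivatives look only forward: whether a continuation \<open>u\<close> of \<open>s\<close> survives depends on the continuations
  of \<open>s\<close> alone, and if \<open>u\<close> lies beyond \<open>i\<close>, on those beyond \<open>i\<close>, since a witness for the derivative may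
  be taken further out.  The asymptotic derivative does not preserve closure under
  initial segments; for a set closed under final segments, this lemma with \<open>u = []\<close> is the substitute,
  as it shows that the root survives if any node does.
\<close>

lemma derivative_iter_suffix:
  assumes mono: "\<And>i j y. P j y \<Longrightarrow> i \<le> j \<Longrightarrow> P i y"
    and "s @ u \<in> derivative_iter (branching_derivative P) T \<xi>" and "\<forall>x\<in>set u. P i x"
  shows "u \<in> derivative_iter (branching_derivative P) {v. s @ v \<in> T \<and> (\<forall>x\<in>set v. P i x)} \<xi>"
  using assms(2,3)
proof (induction \<xi> arbitrary: u rule: ordinal_induct)
  case (osuc \<xi>)
  let ?S = "derivative_iter (branching_derivative P) T \<xi>"
  have u: "s @ u \<in> ?S" and ext: "\<And>j. \<exists>y. P j y \<and> s @ u @ [y] \<in> ?S"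
    using osuc.prems(1) by (simp_all add: in_branching_derivative_iff)
  have "\<exists>y. P j y \<and> u @ [y] \<in> derivative_iter (branching_derivative P)
      {v. s @ v \<in> T \<and> (\<forall>x\<in>set v. P i x)} \<xi>" for j
  proof -
    obtain y where y: "P (max i j) y" "s @ u @ [y] \<in> ?S" using ext by blast
    then have "P i y" "P j y" using mono by (meson max.cobounded1 max.cobounded2)+
    then show ?thesis using osuc.IH[of "u @ [y]"] y(2) osuc.prems(2) by auto
  qed
  then show ?case using osuc.IH[OF u] osuc.prems(2) by (simp add: in_branching_derivative_iff)
qed auto

text \<open>
  James's dichotomy in abstract form.  Think of \<open>T\<close>, \<open>A\<close>, \<open>B\<close> as the trees for the constants \<open>C K\<close>,
  \<open>C\<close>, \<open>K\<close> and of \<open>block u z\<close> as: \<open>z\<close> is a renormalised linear combination of \<open>u\<close> witnessing that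
  \<open>u\<close> is bad for the constant \<open>C\<close>.
\<close>

locale blocking =
  fixes T A B :: "'a list set" and block :: "'a list \<Rightarrow> 'a \<Rightarrow> bool"
  assumes blocks_in: "concat us \<in> T \<Longrightarrow> list_all2 block us ys \<Longrightarrow> ys \<in> B"
    and block_exists: "u \<in> T \<Longrightarrow> u \<notin> A \<Longrightarrow> \<exists>z. block u z"
    and suffix_closed: "s @ u \<in> T \<Longrightarrow> u \<in> T"
begin

context
  fixes P :: "nat \<Rightarrow> 'a \<Rightarrow> bool"
  assumes mono: "P j y \<Longrightarrow> i \<le> j \<Longrightarrow> P i y"
    and block_preserves: "u \<in> T \<Longrightarrow> block u z \<Longrightarrow> \<forall>x\<in>set u. P i x \<Longrightarrow> P i z"
begin

abbreviation (input) "D \<equiv> branching_derivative P"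

text \<open>
  In the successor step the continuations of \<open>concat us\<close> beyond \<open>i\<close> form a set whose derivative of order
  \<open>\<alpha>\<close> contains the root.  As that derivative of \<open>A\<close> is empty, some continuation is not in \<open>A\<close>
  and provides the next block, again beyond \<open>i\<close>.
\<close>

lemma blocks_in_derivative:
  assumes \<alpha>: "derivative_iter D A \<alpha> = {}"
  shows "concat us \<in> derivative_iter D T (omult \<alpha> \<xi>) \<Longrightarrow> list_all2 block us ys \<Longrightarrow>
    ys \<in> derivative_iter D B \<xi>"
proof (induction \<xi> arbitrary: us ys rule: ordinal_induct)
  case zero
  then show ?case by (auto intro: blocks_in)
next
  case (limit \<xi>)
  have "concat us \<in> derivative_iter D T (omult \<alpha> \<zeta>)" if "\<zeta> < \<xi>" for \<zeta>
    using limit.prems(1) branching_iter_antimono[OF omult_le_limit[OF limit(1) that]]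
    by (rule subsetD[rotated])
  then have "ys \<in> derivative_iter D B \<zeta>" if "\<zeta> < \<xi>" for \<zeta>
    using limit.IH[OF that] limit.prems(2) that by blast
  then show ?case using limit.hyps by simp
next
  case (osuc \<xi>)
  let ?S = "derivative_iter D T (omult \<alpha> \<xi>)"
  have T: "v \<in> T" if "v \<in> ?S" for v
    using that branching_iter_antimono[OF zero_ordinal_le] by fastforce
  have us: "concat us \<in> derivative_iter D ?S \<alpha>"
    using osuc.prems(1) branching_iter_oadd_subset[of P T "omult \<alpha> \<xi>" \<alpha>]
    by (simp add: subsetD)
  then have "concat us \<in> ?S"
    using branching_iter_antimono[OF zero_ordinal_le] by fastforce
  then have "ys \<in> derivative_iter D B \<xi>" using osuc by blast
  moreover have "\<exists>z. P i z \<and> ys @ [z] \<in> derivative_iter D B \<xi>" for i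
  proof -
    \<comment> \<open>the continuations beyond \<open>i\<close>, one of which must leave \<open>A\<close>\<close>
    let ?V = "{v. concat us @ v \<in> ?S \<and> (\<forall>x\<in>set v. P i x)}"
    have "[] \<in> derivative_iter D ?V \<alpha>"
      using derivative_iter_suffix[of P "concat us" "[]", OF mono] us by simp
    then have "\<not> ?V \<subseteq> A"
      using branching_iter_mono \<alpha> by blast
    then obtain u where u: "concat us @ u \<in> ?S" "\<forall>x\<in>set u. P i x" "u \<notin> A" by blast
    have uT: "u \<in> T" using T[OF u(1)] by (rule suffix_closed)
    then obtain z where z: "block u z" using u(3) block_exists by blast
    have "ys @ [z] \<in> derivative_iter D B \<xi>"
      using osuc.IH[of "us @ [u]" "ys @ [z]"] u(1) osuc.prems(2) z by (simp add: list_all2_appendI)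
    then show ?thesis using block_preserves[OF uT z u(2)] by blast
  qed
  ultimately show ?case by (simp add: in_branching_derivative_iff)
qed

lemma derivative_iter_omult_empty:
  assumes "derivative_iter D A \<alpha> = {}" and "derivative_iter D B \<beta> = {}"
  shows "derivative_iter D T (omult \<alpha> \<beta>) = {}"
proof (rule ccontr)
  assume "derivative_iter D T (omult \<alpha> \<beta>) \<noteq> {}"
  then obtain s where "s \<in> derivative_iter D T (omult \<alpha> \<beta>)" by blast
  then have "[] \<in> derivative_iter D {v. s @ v \<in> T \<and> (\<forall>x\<in>set v. P 0 x)} (omult \<alpha> \<beta>)"
    using derivative_iter_suffix[of P s "[]", OF mono] by simp
  moreover have "{v. s @ v \<in> T \<and> (\<forall>x\<in>set v. P 0 x)} \<subseteq> T" using suffix_closed by blast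
  ultimately have "[] \<in> derivative_iter D T (omult \<alpha> \<beta>)"
    by (rule subsetD[OF branching_iter_mono, rotated])
  then have "concat [] \<in> derivative_iter D T (omult \<alpha> \<beta>)" by (simp only: concat.simps)
  then have "[] \<in> derivative_iter D B \<beta>"
    by (rule blocks_in_derivative[OF assms(1)]) simp
  with assms(2) show False by simp
qed

lemma derivative_order_le_times:
  "derivative_order D T \<le> derivative_order D A * derivative_order D B"
proof (cases "(\<exists>\<xi>. derivative_iter D A \<xi> = {}) \<and> (\<exists>\<xi>. derivative_iter D B \<xi> = {})")
  case True
  define \<alpha> where "\<alpha> = (LEAST \<xi>. derivative_iter D A \<xi> = {})"
  define \<beta> where "\<beta> = (LEAST \<xi>. derivative_iter D B \<xi> = {})"
  have "derivative_iter D A \<alpha> = {}"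
    unfolding \<alpha>_def by (rule LeastI_ex) (rule True[THEN conjunct1])
  moreover have "derivative_iter D B \<beta> = {}"
    unfolding \<beta>_def by (rule LeastI_ex) (rule True[THEN conjunct2])
  ultimately have empty: "derivative_iter D T (omult \<alpha> \<beta>) = {}" by (rule derivative_iter_omult_empty)
  then have "derivative_order D T \<le> Ord (omult \<alpha> \<beta>)"
    unfolding derivative_order_def using Least_le[of "\<lambda>\<xi>. derivative_iter D T \<xi> = {}", OF empty] by auto
  then show ?thesis using True by (simp add: derivative_order_def \<alpha>_def \<beta>_def)
next
  case False
  then have "derivative_order D A * derivative_order D B = Infty"
    by (cases "derivative_order D A") (auto simp: derivative_order_def)
  then show ?thesis by simp
qed

end

end

section \<open>Compositions of families and Schreier families\<close>

definition spreading :: "nat set set \<Rightarrow> bool" where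
  "spreading F \<longleftrightarrow>
     (\<forall>E\<in>F. \<forall>f. strict_mono_on E f \<and> (\<forall>i\<in>E. i \<le> f i) \<longrightarrow> f ` E \<in> F)"

lemma spreadingD:
  "spreading F \<Longrightarrow> E \<in> F \<Longrightarrow> strict_mono_on E f \<Longrightarrow> (\<And>i. i \<in> E \<Longrightarrow> i \<le> f i) \<Longrightarrow> f ` E \<in> F"
  by (simp add: spreading_def)

text \<open>
  Spreading lets a larger strictly increasing map replace a smaller one.  The diagonal argument for
  limit ordinals below therefore needs only a map that dominates, not nested subsequences.
\<close>

lemma spreading_dominated_image:
  fixes f g :: "nat \<Rightarrow> nat"
  assumes "spreading F" and "f ` E \<in> F" and f: "strict_mono f" and g: "strict_mono g"
    and "\<And>i. i \<in> E \<Longrightarrow> f i \<le> g i"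
  shows "g ` E \<in> F"
proof -
  have inv: "inv f (f i) = i" for i using strict_mono_imp_inj_on[OF f] by simp
  have "(g \<circ> inv f) ` (f ` E) \<in> F"
    using assms f g by (intro spreadingD[OF assms(1,2)] strict_mono_onI)
      (auto simp: inv strict_mono_less)
  then show ?thesis by (simp add: image_comp comp_def inv)
qed

lemma Min_image_strict_mono_on:
  fixes f :: "nat \<Rightarrow> nat"
  assumes "finite A" "A \<noteq> {}" "strict_mono_on A f"
  shows "Min (f ` A) = f (Min A)"
proof (rule Min_eqI)
  fix y assume "y \<in> f ` A"
  then obtain x where x: "x \<in> A" "y = f x" by blast
  then show "f (Min A) \<le> y"
    using assms strict_mono_on_leD[OF assms(3), of "Min A" x] by simp
qed (use assms in auto)

lemma family_compI:
  assumes "finite I"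
    and A: "\<And>i. i \<in> I \<Longrightarrow> A i \<in> G" "\<And>i. i \<in> I \<Longrightarrow> A i \<noteq> {}"
    and less: "\<And>i j. i \<in> I \<Longrightarrow> j \<in> I \<Longrightarrow> i < (j :: nat) \<Longrightarrow> Max (A i) < Min (A j)"
    and F: "(\<lambda>i. Min (A i)) ` I \<in> F"
  shows "(\<Union>i\<in>I. A i) \<in> family_comp F G"
proof -
  define l where "l = sorted_list_of_set I"
  have l: "set l = I" "sorted_wrt (<) l" using assms(1) by (auto simp: l_def)
  have I: "(\<lambda>k. l ! k) ` {..<length l} = I" using l(1) by (auto simp: set_conv_nth)
  have in_I: "l ! k \<in> I" if "k < length l" for k using l(1) that nth_mem by blast
  have "(\<Union>i\<in>I. A i) = (\<Union>k<length l. A (l ! k))" unfolding I[symmetric] by simp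
  moreover have "Max (A (l ! k)) < Min (A (l ! Suc k))" if "Suc k < length l" for k
    using that l(2) by (intro less in_I) (auto simp: sorted_wrt_iff_nth_less)
  moreover have "(\<lambda>k. Min (A (l ! k))) ` {..<length l} \<in> F"
    using F unfolding I[symmetric] by (simp add: image_image)
  ultimately show ?thesis
    unfolding family_comp_def using in_I A
    by (intro insertI2 CollectI exI[of _ "length l"] exI[of _ "\<lambda>k. A (l ! k)"]) auto
qed

lemma family_comp_singleI:
  assumes "E \<in> G" and "E \<noteq> {}" and "{Min E} \<in> F"
  shows "E \<in> family_comp F G"
  using family_compI[of "{0}" "\<lambda>_. E" G F] assms by simp

text \<open>
  Since the minima of the pieces increase, the pieces can be indexed by the set \<open>D\<close> of their own
  minima.  This spares all enumeration of pieces in the sequel.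
\<close>

lemma family_comp_cases [consumes 2, case_names empty blocks]:
  assumes "U \<in> family_comp F G" and finG: "\<forall>E\<in>G. finite E"
  obtains "U = {}"
  | D A where "D \<in> F" "finite D" "U = (\<Union>d\<in>D. A d)"
    "\<And>d. d \<in> D \<Longrightarrow> A d \<in> G" "\<And>d. d \<in> D \<Longrightarrow> A d \<noteq> {}" "\<And>d. d \<in> D \<Longrightarrow> Min (A d) = d"
    "\<And>d e. d \<in> D \<Longrightarrow> e \<in> D \<Longrightarrow> d < e \<Longrightarrow> Max (A d) < e"
proof (cases "U = {}")
  case False
  then obtain s A where U: "U = (\<Union>i<s. A i)" and A: "\<And>i. i < s \<Longrightarrow> A i \<in> G \<and> A i \<noteq> {}"
    and consec: "\<And>i. Suc i < s \<Longrightarrow> Max (A i) < Min (A (Suc i))"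
    and F: "(\<lambda>i. Min (A i)) ` {..<s} \<in> F"
    using assms(1) unfolding family_comp_def by auto
  define m where "m = (\<lambda>i. Min (A i))"
  have le: "m i \<le> Max (A i)" if "i < s" for i
    unfolding m_def using A[OF that] finG by (intro Max_ge Min_in) auto
  have less: "Max (A i) < m j" if "i < j" "j < s" for i j
    using that
  proof (induction j)
    case (Suc j)
    show ?case
    proof (cases "i = j")
      case True
      then show ?thesis using consec Suc.prems by (simp add: m_def)
    next
      case False
      then have "Max (A i) < m j" using Suc by auto
      also have "\<dots> \<le> Max (A j)" using Suc.prems by (intro le) simp
      also have "\<dots> < m (Suc j)" using consec Suc.prems by (simp add: m_def)
      finally show ?thesis .
    qed
  qed simp
  have "strict_mono_on {..<s} m"
  proof (rule strict_mono_onI)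
    fix i j assume "i \<in> {..<s}" "j \<in> {..<s}" "i < j"
    then show "m i < m j" using le[of i] less[of i j] by simp
  qed
  then have inj: "inj_on m {..<s}" by (rule strict_mono_on_imp_inj_on)
  define A' where "A' = (\<lambda>d. A (inv_into {..<s} m d))"
  have A': "A' (m i) = A i" if "i < s" for i
    using inj that by (simp add: A'_def)
  have less': "Max (A i) < m j" if "m i < m j" "i < s" "j < s" for i j
  proof -
    have "i < j"
      using that \<open>strict_mono_on {..<s} m\<close> by (metis lessThan_iff linorder_neqE_nat order_less_asym strict_mono_onD)
    then show ?thesis using less that by blast
  qed
  show ?thesis
  proof (rule that(2)[of "m ` {..<s}" A'])
    show "m ` {..<s} \<in> F" using F by (simp add: m_def)
    show "U = (\<Union>d\<in>m ` {..<s}. A' d)" unfolding U using A' by auto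
  qed (use A A' less' in \<open>auto simp: m_def\<close>)
qed (use that in blast)

lemma family_comp_finite:
  assumes "U \<in> family_comp F G" and "\<And>E. E \<in> G \<Longrightarrow> finite E \<and> 0 \<notin> E"
  shows "finite U \<and> 0 \<notin> U"
  using assms(1)
  by (rule family_comp_cases) (use assms(2) in auto)

lemma spreading_family_comp:
  assumes "spreading F" and "spreading G" and finG: "\<forall>E\<in>G. finite E"
  shows "spreading (family_comp F G)"
  unfolding spreading_def
proof (intro ballI allI impI, elim conjE)
  fix U f assume U: "U \<in> family_comp F G" and f: "strict_mono_on U f" "\<forall>i\<in>U. i \<le> f i"
  from U finG show "f ` U \<in> family_comp F G"
  proof (cases rule: family_comp_cases)
    case empty
    then show ?thesis by (simp add: family_comp_def)
  next
    case 2: (blocks D A)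
    have fin: "finite (A d)" if "d \<in> D" for d using 2 finG that by blast
    have sm: "strict_mono_on (A d) f" if "d \<in> D" for d
      using f(1) that 2(3) by (auto simp: strict_mono_on_def)
    have min: "Min (f ` A d) = f d" if "d \<in> D" for d
      using Min_image_strict_mono_on[OF fin[OF that] _ sm[OF that]] 2 that by simp
    have DU: "D \<subseteq> U"
    proof
      fix d assume d: "d \<in> D"
      then have "Min (A d) \<in> A d" using 2 fin by (intro Min_in) auto
      then show "d \<in> U" using 2 d by auto
    qed
    have "(\<Union>d\<in>D. f ` A d) \<in> family_comp F G"
    proof (rule family_compI)
      fix d assume d: "d \<in> D"
      show "f ` A d \<in> G" using 2 d f(2) by (intro spreadingD[OF assms(2)] sm) auto
      show "f ` A d \<noteq> {}" using 2 d by simp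
      fix e assume e: "e \<in> D" "d < e"
      have "Max (f ` A d) \<in> f ` A d" using 2 d fin by (intro Max_in) auto
      then obtain x where x: "x \<in> A d" "Max (f ` A d) = f x" by auto
      have "x \<le> Max (A d)" using x fin d by simp
      then have "x < e" using 2(7)[OF d e] by simp
      moreover have "x \<in> U" "e \<in> U" using x(1) 2(3) d DU e(1) by auto
      ultimately show "Max (f ` A d) < Min (f ` A e)"
        unfolding x(2) min[OF e(1)] using strict_mono_onD[OF f(1)] by blast
    next
      have "f ` D \<in> F"
        using 2(1) f DU by (intro spreadingD[OF assms(1)]) (auto simp: strict_mono_on_def)
      then show "(\<lambda>d. Min (f ` A d)) ` D \<in> F" using min by (simp cong: image_cong)
    qed (use 2 in auto)
    then show ?thesis using 2(3) by (simp add: image_UN)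
  qed
qed

lemma schreier_finite: "E \<in> schreier q \<xi> \<Longrightarrow> finite E \<and> 0 \<notin> E"
proof (induction \<xi> arbitrary: E rule: ordinal_induct)
  case zero
  then show ?case by (simp add: schreier0_def)
next
  case (osuc \<xi>)
  show ?case
    by (rule family_comp_finite[of E schreier1 "schreier q \<xi>"]) (use osuc in auto)
next
  case (limit \<xi>)
  then show ?case by (auto split: if_splits dest: osuc_less_olimit)
qed

lemma empty_in_schreier: "{} \<in> schreier q \<xi>"
  by (cases \<xi> rule: ordinal_cases) (auto simp: schreier0_def family_comp_def)

lemma spreading_schreier1: "spreading schreier1"
  unfolding spreading_def
proof (intro ballI allI impI, elim conjE)
  fix E f assume E: "E \<in> schreier1" and f: "strict_mono_on E f" "\<forall>i\<in>E. i \<le> f i"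
  show "f ` E \<in> schreier1"
  proof (cases "E = {}")
    case False
    then have fin: "finite E" "0 \<notin> E" "card E \<le> Min E" using E by (auto simp: schreier1_def)
    have "card (f ` E) \<le> card E" using fin(1) by (rule card_image_le)
    also have "\<dots> \<le> Min E" by (rule fin)
    also have "\<dots> \<le> Min (f ` E)"
      using f fin False by (simp add: Min_image_strict_mono_on)
    finally show ?thesis using fin f(2) False by (fastforce simp: schreier1_def)
  qed (simp add: schreier1_def)
qed

lemma spreading_schreier: "spreading (schreier q \<xi>)"
proof (induction \<xi> rule: ordinal_induct)
  case zero
  show ?case
    unfolding spreading_def
  proof (intro ballI allI impI, elim conjE)
    fix E f assume E: "E \<in> schreier q 0" and f: "strict_mono_on E f" "\<forall>i\<in>E. i \<le> f i"
    have fin: "finite E" "0 \<notin> E" "card E \<le> 1" using E by (auto simp: schreier0_def)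
    have "card (f ` E) \<le> 1" using card_image_le[OF fin(1), of f] fin(3) by simp
    then show "f ` E \<in> schreier q 0" using fin f(2) by (fastforce simp: schreier0_def)
  qed
next
  case (osuc \<xi>)
  have "spreading (family_comp schreier1 (schreier q \<xi>))"
    by (rule spreading_family_comp[OF spreading_schreier1 osuc]) (simp add: schreier_finite)
  then show ?case by simp
next
  case (limit \<xi>)
  show ?case
    unfolding spreading_def
  proof (intro ballI allI impI, elim conjE)
    fix E f assume E: "E \<in> schreier q \<xi>" and f: "strict_mono_on E f" "\<forall>i\<in>E. i \<le> f i"
    have fin: "finite E" "0 \<notin> E" using schreier_finite E by blast+
    show "f ` E \<in> schreier q \<xi>"
    proof (cases "\<xi> < omega1 \<and> E \<noteq> {}")
      case True
      then obtain n where n: "1 \<le> n" "n \<le> Min E" "q \<xi> n < \<xi>" "E \<in> schreier q (osuc (q \<xi> n))"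
        using E limit(1) by auto
      have "f ` E \<in> schreier q (osuc (q \<xi> n))"
        using limit n f by (intro spreadingD[OF limit(2)] osuc_less_olimit) auto
      moreover have "n \<le> Min (f ` E)"
      proof -
        have "n \<le> Min E" by fact
        also have "\<dots> \<le> f (Min E)" using f(2) fin True by simp
        also have "\<dots> = Min (f ` E)" using fin f(1) True by (simp add: Min_image_strict_mono_on)
        finally show ?thesis .
      qed
      ultimately show ?thesis using True limit(1) n by auto
    next
      case False
      then show ?thesis using limit(1) fin f(2) by (fastforce split: if_splits)
    qed
  qed
qed

lemma schreier_choice_less: "schreier_choice q \<Longrightarrow> olimit \<xi> \<Longrightarrow> \<xi> < omega1 \<Longrightarrow> 1 \<le> n \<Longrightarrow> q \<xi> n < \<xi>"
  by (simp add: schreier_choice_def)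

lemma schreier_choice_cofinal:
  "schreier_choice q \<Longrightarrow> olimit \<xi> \<Longrightarrow> \<xi> < omega1 \<Longrightarrow> \<zeta> < \<xi> \<Longrightarrow> \<exists>n\<ge>1. \<zeta> < q \<xi> n"
  by (simp add: schreier_choice_def)

lemma schreier_subset_osuc: "schreier q \<xi> \<subseteq> schreier q (osuc \<xi>)"
proof
  fix E assume E: "E \<in> schreier q \<xi>"
  show "E \<in> schreier q (osuc \<xi>)"
  proof (cases "E = {}")
    case True
    then show ?thesis using empty_in_schreier by blast
  next
    case False
    have "finite E" "0 \<notin> E" using schreier_finite[OF E] by auto
    then have "Min E \<in> E" "Min E \<noteq> 0" using False Min_in by metis+
    then have "{Min E} \<in> schreier1" by (simp add: schreier1_def)
    then have "E \<in> family_comp schreier1 (schreier q \<xi>)"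
      by (rule family_comp_singleI[OF E False])
    then show ?thesis by simp
  qed
qed

lemma singleton_in_schreier:
  assumes "schreier_choice q" and "1 \<le> n"
  shows "{n} \<in> schreier q \<xi>"
proof (induction \<xi> rule: ordinal_induct)
  case zero
  then show ?case using assms(2) by (simp add: schreier0_def)
next
  case (osuc \<xi>)
  then show ?case using schreier_subset_osuc by blast
next
  case (limit \<xi>)
  show ?case
  proof (cases "\<xi> < omega1")
    case True
    have lt: "q \<xi> 1 < \<xi>" by (rule schreier_choice_less[OF assms(1) limit(1) True order_refl])
    moreover have "{n} \<in> schreier q (osuc (q \<xi> 1))"
      by (rule limit(2)[OF osuc_less_olimit[OF limit(1) lt]])
    ultimately show ?thesis using limit(1) True assms(2) by auto
  next
    case False
    then show ?thesis using limit(1) assms(2) by simp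
  qed
qed

text \<open>
  The families are not increasing in the ordinal, but they are so up to sets with small minima:
  at a limit \<open>\<xi>\<close> one takes some \<open>q \<xi> n\<close> above \<open>\<zeta>\<close> and discards, besides the sets discarded on the way
  to \<open>q \<xi> n\<close>, those that begin before \<open>n\<close>.
\<close>

lemma schreier_almost_mono:
  assumes q: "schreier_choice q" and "\<zeta> \<le> \<xi>" and "\<xi> < omega1"
  shows "\<exists>p. \<forall>E\<in>schreier q \<zeta>. E \<noteq> {} \<and> p \<le> Min E \<longrightarrow> E \<in> schreier q \<xi>"
  using assms(2,3)
proof (induction \<xi> rule: ordinal_induct)
  case zero
  then have "\<zeta> = 0" by (intro order_antisym) auto
  then show ?case by blast
next
  case (osuc \<xi>)
  show ?case
  proof (cases "\<zeta> = osuc \<xi>")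
    case False
    then have "\<zeta> \<le> \<xi>" using osuc.prems(1) by (metis less_osuc_iff order_le_less)
    moreover have "\<xi> < omega1" using osuc.prems(2) osuc_greater order_less_trans by blast
    ultimately have "\<exists>p. \<forall>E\<in>schreier q \<zeta>. E \<noteq> {} \<and> p \<le> Min E \<longrightarrow> E \<in> schreier q \<xi>"
      by (rule osuc.IH)
    then obtain p where "\<forall>E\<in>schreier q \<zeta>. E \<noteq> {} \<and> p \<le> Min E \<longrightarrow> E \<in> schreier q \<xi>" ..
    then show ?thesis using schreier_subset_osuc[of q \<xi>] by (intro exI[of _ p]) blast
  qed blast
next
  case (limit \<xi>)
  show ?case
  proof (cases "\<zeta> = \<xi>")
    case False
    then have "\<zeta> < \<xi>" using limit.prems(1) by simp
    then obtain n where n: "1 \<le> n" "\<zeta> < q \<xi> n"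
      using schreier_choice_cofinal[OF q limit.hyps limit.prems(2)] by blast
    have lt: "q \<xi> n < \<xi>" by (rule schreier_choice_less[OF q limit.hyps limit.prems(2) n(1)])
    then have "osuc (q \<xi> n) < \<xi>" by (rule osuc_less_olimit[OF limit.hyps])
    moreover have "\<zeta> \<le> osuc (q \<xi> n)" using n(2) osuc_greater order_less_trans order_less_imp_le by blast
    moreover have "osuc (q \<xi> n) < omega1" using calculation(1) limit.prems(2) by (rule order_less_trans)
    ultimately obtain p where p: "\<And>E. E \<in> schreier q \<zeta> \<Longrightarrow> E \<noteq> {} \<Longrightarrow> p \<le> Min E \<Longrightarrow> E \<in> schreier q (osuc (q \<xi> n))"
      using limit.IH by metis
    have *: "E \<in> schreier q \<xi>" if "E \<in> schreier q \<zeta>" "E \<noteq> {}" "max p n \<le> Min E" for E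
    proof -
      have "E \<in> schreier q (osuc (q \<xi> n))" using p that by simp
      then show ?thesis using limit.hyps limit.prems(2) n(1) lt that(2,3) by auto
    qed
    show ?thesis by (intro exI[of _ "max p n"] ballI impI, elim conjE) (rule *)
  qed blast
qed

text \<open>
  A single sequence eventually dominates countably many, the \<open>n\<close>-th one from \<open>n\<close> on.
\<close>

lemma strict_mono_dominating:
  fixes h :: "nat \<Rightarrow> nat \<Rightarrow> nat"
  shows "\<exists>g. strict_mono g \<and> (\<forall>n i. n \<le> i \<longrightarrow> h n i \<le> g i)"
proof -
  define g where "g = (\<lambda>i. i + (\<Sum>k\<le>i. \<Sum>n\<le>k. h n k))"
  have "strict_mono g" unfolding g_def by (rule strict_mono_Suc_iff[THEN iffD2]) simp
  moreover have "h n i \<le> g i" if "n \<le> i" for n i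
  proof -
    have "h n i \<le> (\<Sum>n\<le>i. h n i)" using that by (intro member_le_sum) auto
    also have "\<dots> \<le> (\<Sum>k\<le>i. \<Sum>n\<le>k. h n k)" by (intro member_le_sum[of i]) auto
    finally show ?thesis by (simp add: g_def)
  qed
  ultimately show ?thesis by blast
qed

text \<open>
  Associativity of the composition in one direction: the pieces whose minima lie in one piece of the
  outer composition are united to a member of \<open>F[G]\<close>, and the map \<open>g\<close> acts on these unions.
\<close>

lemma family_comp_schreier1_comp:
  assumes g: "strict_mono g"
    and sub: "\<And>U. U \<in> family_comp F G \<Longrightarrow> g ` U \<in> H"
    and finF: "\<forall>E\<in>F. finite E" and finG: "\<forall>E\<in>G. finite E"
    and U: "U \<in> family_comp (family_comp schreier1 F) G"
  shows "g ` U \<in> family_comp schreier1 H"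
  using U finG
proof (cases rule: family_comp_cases)
  case empty
  then show ?thesis by (simp add: family_comp_def)
next
  case 2: (blocks D A)
  from 2(1) finF show ?thesis
  proof (cases rule: family_comp_cases)
    case empty
    then show ?thesis using 2(3) by (simp add: family_comp_def)
  next
    case D: (blocks B C)
    define V where "V = (\<lambda>b. \<Union>d\<in>C b. A d)"
    have CD: "C b \<subseteq> D" if "b \<in> B" for b using D(3) that by blast
    have finC: "finite (C b)" if "b \<in> B" for b using D(4) finF that by blast
    have finA: "finite (A d)" if "d \<in> D" for d using 2(4) finG that by blast
    have mem: "d \<in> A d" if "d \<in> D" for d using Min_in[OF finA[OF that]] 2(5,6)[OF that] by simp
    have bC: "b \<in> C b" if "b \<in> B" for b using Min_in[OF finC[OF that]] D(5,6)[OF that] by simp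
    have finV: "finite (V b)" if "b \<in> B" for b
      unfolding V_def using finC[OF that] finA CD[OF that] by (intro finite_UN_I) auto
    have VFG: "V b \<in> family_comp F G" if b: "b \<in> B" for b
      unfolding V_def
    proof (rule family_compI)
      show "(\<lambda>d. Min (A d)) ` C b \<in> F"
        using D(4)[OF b] 2(6) CD[OF b] by (simp cong: image_cong add: subset_iff)
    qed (use 2 finC CD b in \<open>auto simp: subset_iff\<close>)
    have bV: "b \<in> V b" if "b \<in> B" for b
      unfolding V_def using bC[OF that] mem CD[OF that] by blast
    have minV: "Min (V b) = b" if b: "b \<in> B" for b
    proof (rule Min_eqI)
      fix x assume "x \<in> V b"
      then obtain d where d: "d \<in> C b" "x \<in> A d" by (auto simp: V_def)
      have "b \<le> d" using D(6)[OF b] finC[OF b] d(1) by (metis Min_le)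
      also have "d \<le> x" using 2(6) finA d CD[OF b] by (metis Min_le subsetD)
      finally show "b \<le> x" .
    qed (use finV bV b in auto)
    have minG: "Min (g ` V b) = g b" if b: "b \<in> B" for b
      using Min_image_strict_mono_on[OF finV[OF b], of g] bV[OF b] minV[OF b] g
      by (auto simp: strict_mono_on_def strict_mono_def)
    have "(\<Union>b\<in>B. g ` V b) \<in> family_comp schreier1 H"
    proof (rule family_compI)
      fix b assume b: "b \<in> B"
      show "g ` V b \<in> H" using sub VFG b by blast
      show "g ` V b \<noteq> {}" using bV b by blast
      fix b' assume b': "b' \<in> B" "b < b'"
      have "Max (g ` V b) \<in> g ` V b" using finV bV b by (intro Max_in) auto
      then obtain x where x: "x \<in> V b" "Max (g ` V b) = g x" by auto
      obtain d where d: "d \<in> C b" "x \<in> A d" using x(1) by (auto simp: V_def)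
      have dD: "d \<in> D" using d CD b by blast
      have "d \<le> Max (C b)" using finC b d by simp
      also have "\<dots> < b'" using D(7) b b' by blast
      finally have "Max (A d) < b'" using 2(7) dD bC CD b'(1) by blast
      then have "x < b'" using finA[OF dD] d(2) by (meson Max_ge order_le_less_trans)
      then show "Max (g ` V b) < Min (g ` V b')"
        unfolding x(2) minG[OF b'(1)] using g by (simp add: strict_mono_less)
    next
      have "g ` B \<in> schreier1"
        using g by (intro spreadingD[OF spreading_schreier1 D(1)])
          (auto simp: strict_mono_on_def strict_mono_def strict_mono_imp_increasing)
      then show "(\<lambda>b. Min (g ` V b)) ` B \<in> schreier1" using minG by (simp cong: image_cong)
    qed (use D in auto)
    moreover have "g ` U = (\<Union>b\<in>B. g ` V b)" unfolding 2(3) D(3) V_def by blast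
    ultimately show ?thesis by simp
  qed
qed

text \<open>
  For \<open>\<beta>\<close> a limit, the sequences chosen for \<open>\<beta>\<close> and for \<open>\<alpha> + \<beta>\<close> are unrelated.  A set of the
  composition that begins at or after \<open>n\<close> belongs to the composition for some \<open>\<gamma> n < \<beta>\<close>, so by induction
  \<open>f n\<close> maps it into the family of order \<open>\<alpha> + \<gamma> n < \<alpha> + \<beta>\<close>, and almost monotonicity brings it to \<open>\<alpha> + \<beta>\<close>
  once its image begins after \<open>p n\<close>.  A map that dominates \<open>f n + p n\<close> from \<open>n\<close> on achieves both for every
  \<open>n\<close>.
\<close>

lemma schreier_comp_into_oadd:
  assumes q: "schreier_choice q" and "oadd \<alpha> \<beta> < omega1"
  shows "\<exists>g. strict_mono g \<and>
    (\<forall>U\<in>family_comp (schreier q \<beta>) (schreier q \<alpha>). g ` U \<in> schreier q (oadd \<alpha> \<beta>))"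
  using assms(2)
proof (induction \<beta> rule: ordinal_induct)
  case zero
  have "U \<in> schreier q \<alpha>" if "U \<in> family_comp (schreier q 0) (schreier q \<alpha>)" for U
    using that
  proof (rule family_comp_cases)
    fix D A assume D: "D \<in> schreier q 0" "U = (\<Union>d\<in>D. A d)" "\<And>d. d \<in> D \<Longrightarrow> A d \<in> schreier q \<alpha>"
    then have "finite D" "card D \<le> 1" by (auto simp: schreier0_def)
    then consider "D = {}" | d where "D = {d}"
      by (metis card_0_eq card_1_singletonE le_antisym less_one not_le)
    then show ?thesis by cases (use D(2,3) empty_in_schreier in auto)
  qed (auto simp: schreier_finite empty_in_schreier)
  then show ?case by (intro exI[of _ id]) (auto simp: strict_mono_def)
next
  case (osuc \<beta>)
  have "oadd \<alpha> \<beta> < omega1" by (rule order_less_trans[OF oadd_strict_mono[OF osuc_greater] osuc.prems])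
  from osuc.IH[OF this] obtain g where g: "strict_mono g"
    "\<And>U. U \<in> family_comp (schreier q \<beta>) (schreier q \<alpha>) \<Longrightarrow> g ` U \<in> schreier q (oadd \<alpha> \<beta>)"
    by blast
  have "g ` U \<in> schreier q (oadd \<alpha> (osuc \<beta>))"
    if "U \<in> family_comp (schreier q (osuc \<beta>)) (schreier q \<alpha>)" for U
  proof -
    have "U \<in> family_comp (family_comp schreier1 (schreier q \<beta>)) (schreier q \<alpha>)"
      using that by simp
    then have "g ` U \<in> family_comp schreier1 (schreier q (oadd \<alpha> \<beta>))"
      using schreier_finite by (intro family_comp_schreier1_comp[OF g]) blast+
    then show ?thesis by simp
  qed
  then show ?case using g(1) by blast
next
  case (limit \<beta>)
  have \<beta>: "\<beta> < omega1" using le_oadd_right limit.prems by (rule order_le_less_trans)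
  define \<gamma> where "\<gamma> = (\<lambda>n. osuc (q \<beta> n))"
  have \<gamma>: "\<gamma> n < \<beta>" if "1 \<le> n" for n
    unfolding \<gamma>_def
    by (rule osuc_less_olimit[OF limit.hyps schreier_choice_less[OF q limit.hyps \<beta> that]])
  have lt: "oadd \<alpha> (\<gamma> n) < oadd \<alpha> \<beta>" if "1 \<le> n" for n by (rule oadd_strict_mono[OF \<gamma>[OF that]])
  have "\<exists>f p. strict_mono f
      \<and> (\<forall>U\<in>family_comp (schreier q (\<gamma> n)) (schreier q \<alpha>). f ` U \<in> schreier q (oadd \<alpha> (\<gamma> n)))
      \<and> (\<forall>E\<in>schreier q (oadd \<alpha> (\<gamma> n)). E \<noteq> {} \<and> p \<le> Min E \<longrightarrow> E \<in> schreier q (oadd \<alpha> \<beta>))"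
    if n: "1 \<le> n" for n
  proof -
    obtain f where "strict_mono f"
      "\<forall>U\<in>family_comp (schreier q (\<gamma> n)) (schreier q \<alpha>). f ` U \<in> schreier q (oadd \<alpha> (\<gamma> n))"
      using limit.IH[OF \<gamma>[OF n] order_less_trans[OF lt[OF n] limit.prems]] by blast
    moreover obtain p where
      "\<forall>E\<in>schreier q (oadd \<alpha> (\<gamma> n)). E \<noteq> {} \<and> p \<le> Min E \<longrightarrow> E \<in> schreier q (oadd \<alpha> \<beta>)"
      using schreier_almost_mono[OF q order_less_imp_le[OF lt[OF n]] limit.prems] by blast
    ultimately show ?thesis by blast
  qed
  then obtain f p where f: "\<And>n. 1 \<le> n \<Longrightarrow> strict_mono (f n)"
    and f_in: "\<And>n U. 1 \<le> n \<Longrightarrow> U \<in> family_comp (schreier q (\<gamma> n)) (schreier q \<alpha>) \<Longrightarrow>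
      f n ` U \<in> schreier q (oadd \<alpha> (\<gamma> n))"
    and p: "\<And>n E. 1 \<le> n \<Longrightarrow> E \<in> schreier q (oadd \<alpha> (\<gamma> n)) \<Longrightarrow> E \<noteq> {} \<Longrightarrow> p n \<le> Min E \<Longrightarrow>
      E \<in> schreier q (oadd \<alpha> \<beta>)"
    by metis
  obtain g where g: "strict_mono g" and dom: "\<And>n i. n \<le> i \<Longrightarrow> f n i + p n \<le> g i"
    using strict_mono_dominating[of "\<lambda>n i. f n i + p n"] by blast
  have "g ` U \<in> schreier q (oadd \<alpha> \<beta>)"
    if U: "U \<in> family_comp (schreier q \<beta>) (schreier q \<alpha>)" for U
    using U
  proof (rule family_comp_cases)
    fix D A assume D: "D \<in> schreier q \<beta>" "finite D" "U = (\<Union>d\<in>D. A d)"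
      and A: "\<And>d. d \<in> D \<Longrightarrow> A d \<in> schreier q \<alpha>" "\<And>d. d \<in> D \<Longrightarrow> A d \<noteq> {}"
        "\<And>d. d \<in> D \<Longrightarrow> Min (A d) = d" "\<And>d e. d \<in> D \<Longrightarrow> e \<in> D \<Longrightarrow> d < e \<Longrightarrow> Max (A d) < e"
    show ?thesis
    proof (cases "D = {}")
      case True
      then show ?thesis using D(3) empty_in_schreier by simp
    next
      case False
      then obtain n where n: "1 \<le> n" "n \<le> Min D" "D \<in> schreier q (\<gamma> n)"
        using D(1) limit.hyps \<beta> by (auto simp: \<gamma>_def)
      have finA: "finite (A d)" if "d \<in> D" for d using A(1)[OF that] schreier_finite by blast
      have "U \<in> family_comp (schreier q (\<gamma> n)) (schreier q \<alpha>)"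
        unfolding D(3)
      proof (rule family_compI)
        show "(\<lambda>d. Min (A d)) ` D \<in> schreier q (\<gamma> n)" using n(3) A(3) by (simp cong: image_cong)
      qed (use A D(2) in auto)
      then have fU: "f n ` U \<in> schreier q (oadd \<alpha> (\<gamma> n))" by (rule f_in[OF n(1)])
      have ge: "n \<le> x" if x: "x \<in> U" for x
      proof -
        obtain d where d: "d \<in> D" "x \<in> A d" using x D(3) by blast
        have "n \<le> d" using n(2) D(2) d(1) by (meson Min_le order_trans)
        also have "d \<le> x" using A(3)[OF d(1)] finA[OF d(1)] d(2) by (metis Min_le)
        finally show ?thesis .
      qed
      have "g ` U \<in> schreier q (oadd \<alpha> (\<gamma> n))"
        using dom ge by (intro spreading_dominated_image[OF spreading_schreier fU f[OF n(1)] g])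
          (meson add_leD1)
      moreover have U_ne: "U \<noteq> {}" using D(3) A(2) False by blast
      moreover have "p n \<le> Min (g ` U)"
      proof (rule Min.boundedI)
        show "finite (g ` U)" using D finA by simp
        fix y assume "y \<in> g ` U"
        then show "p n \<le> y" using dom ge by (auto dest: add_leD2)
      qed (use U_ne in simp)
      ultimately show ?thesis by (intro p[OF n(1)]) auto
    qed
  qed (auto simp: schreier_finite empty_in_schreier)
  then show ?case using g by blast
qed

lemma olimit_omega1: "olimit (omega1 :: 'a ordinal)"
proof -
  have "(omega1 :: 'a ordinal) \<noteq> 0"
  proof
    assume "(omega1 :: 'a ordinal) = 0"
    moreover have "\<not> \<alpha> < 0" for \<alpha> :: "'a ordinal" by (simp add: not_less)
    then have "{..<(0 :: 'a ordinal)} = {}" by blast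
    ultimately show False using uncountable_below_omega1[where 'a = 'a] by simp
  qed
  moreover have "omega1 \<noteq> osuc \<eta>" for \<eta> :: "'a ordinal"
  proof
    assume eq: "omega1 = osuc \<eta>"
    then have "countable {..<\<eta>}"
      unfolding omega1_def by (metis not_less_Least osuc_greater)
    moreover have "{..<omega1} = insert \<eta> {..<\<eta>}" unfolding eq by auto
    ultimately show False using uncountable_below_omega1[where 'a = 'a] by simp
  qed
  ultimately show ?thesis by (simp add: olimit_def)
qed

lemma schreier_omega1: "schreier q omega1 = {E. finite E \<and> 0 \<notin> E}"
  by (simp add: olimit_omega1)

section \<open>Blocks of infinite sequences\<close>

lemma sorted_list_of_set_image:
  fixes f :: "nat \<Rightarrow> nat"
  assumes "finite E" and "strict_mono_on E f"
  shows "sorted_list_of_set (f ` E) = map f (sorted_list_of_set E)"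
proof (rule strict_sorted_equal)
  show "sorted_wrt (<) (map f (sorted_list_of_set E))"
    unfolding sorted_wrt_map
    by (rule sorted_wrt_mono_rel[OF _ strict_sorted_list_of_set])
      (use assms in \<open>auto dest: strict_mono_onD\<close>)
qed (use assms in auto)

lemma subseq_list_image:
  "finite E \<Longrightarrow> strict_mono_on E f \<Longrightarrow> subseq_list x (f ` E) = subseq_list (x \<circ> f) E"
  by (simp add: subseq_list_def sorted_list_of_set_image)

lemma sorted_list_of_set_UN:
  fixes A :: "nat \<Rightarrow> nat set"
  assumes "finite I" and fin: "\<And>i. finite (A i)"
    and less: "\<And>i j x y. i < j \<Longrightarrow> x \<in> A i \<Longrightarrow> y \<in> A j \<Longrightarrow> x < y"
  shows "sorted_list_of_set (\<Union>i\<in>I. A i) =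
    concat (map (\<lambda>i. sorted_list_of_set (A i)) (sorted_list_of_set I))"
proof (rule strict_sorted_equal)
  have "sorted_wrt (<) (concat (map (\<lambda>i. sorted_list_of_set (A i)) l))"
    if "sorted_wrt (<) l" for l
    using that by (induction l) (use fin less in \<open>auto simp: sorted_wrt_append\<close>)
  then show "sorted_wrt (<) (concat (map (\<lambda>i. sorted_list_of_set (A i)) (sorted_list_of_set I)))"
    by simp
qed (use assms in auto)

lemma subseq_list_UN:
  fixes A :: "nat \<Rightarrow> nat set"
  assumes "finite I" and "\<And>i. finite (A i)"
    and "\<And>i j x y. i < j \<Longrightarrow> x \<in> A i \<Longrightarrow> y \<in> A j \<Longrightarrow> x < y"
  shows "subseq_list x (\<Union>i\<in>I. A i) = concat (map (\<lambda>i. subseq_list x (A i)) (sorted_list_of_set I))"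
  using sorted_list_of_set_UN[OF assms] by (simp add: subseq_list_def map_concat comp_def)

context blocking
begin

text \<open>
  No shift of the sequence is good along \<open>G\<close>, hence there are bad members of \<open>G\<close> arbitrarily far out.  They
  are chosen successively, so the minimum of the set with index \<open>k\<close> is at least \<open>k\<close> and, by spreading of \<open>F\<close>, the union of those with
  index in a member of \<open>F\<close> is in \<open>F[G]\<close>.
\<close>

lemma block_sequence:
  assumes spF: "spreading F" and spG: "spreading G"
    and finF: "\<And>E. E \<in> F \<Longrightarrow> finite E \<and> 0 \<notin> E" and finG: "\<And>E. E \<in> G \<Longrightarrow> finite E \<and> 0 \<notin> E"
    and single: "\<And>n. 1 \<le> n \<Longrightarrow> {n} \<in> F"
    and g: "strict_mono g" and sub: "\<And>U. U \<in> family_comp F G \<Longrightarrow> g ` U \<in> H"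
    and x: "\<And>E. E \<in> H \<Longrightarrow> subseq_list x E \<in> T"
    and "[] \<in> A" and noA: "\<not> (\<exists>x'. \<forall>E\<in>G. subseq_list x' E \<in> A)"
  shows "\<exists>y. \<forall>E\<in>F. subseq_list y E \<in> B"
proof -
  define x' where "x' = x \<circ> g"
  have x': "subseq_list x' U \<in> T" if "U \<in> family_comp F G" for U
  proof -
    have "finite U" using family_comp_finite[OF that finG] by blast
    moreover have "strict_mono_on U g" using g by (auto simp: strict_mono_on_def strict_mono_def)
    ultimately show ?thesis using x[OF sub[OF that]] by (simp add: subseq_list_image x'_def)
  qed
  have ex: "\<exists>E z. E \<in> G \<and> E \<noteq> {} \<and> N < Min E \<and> block (subseq_list x' E) z" for N
  proof -
    obtain E where E: "E \<in> G" "subseq_list (x' \<circ> (\<lambda>i. i + N)) E \<notin> A" using noA by blast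
    let ?E = "(\<lambda>i. i + N) ` E"
    have sm: "strict_mono_on E (\<lambda>i. i + N)" by (simp add: strict_mono_on_def)
    have fin: "finite E" "0 \<notin> E" using finG E by blast+
    have ne: "E \<noteq> {}" using E(2) \<open>[] \<in> A\<close> by (auto simp: subseq_list_def)
    have EG: "?E \<in> G" by (rule spreadingD[OF spG E(1) sm]) simp
    have "Min ?E = Min E + N" using fin ne sm by (simp add: Min_image_strict_mono_on)
    moreover have "Min E \<noteq> 0" using fin ne Min_in by metis
    ultimately have min: "N < Min ?E" by simp
    have "?E \<in> family_comp F G"
      using ne min single by (intro family_comp_singleI[OF EG]) auto
    then have "subseq_list x' ?E \<in> T" using x' by simp
    moreover have "subseq_list x' ?E \<notin> A" using E(2) fin sm by (simp add: subseq_list_image)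
    ultimately obtain z where "block (subseq_list x' ?E) z" using block_exists by blast
    then show ?thesis using EG ne min by blast
  qed
  then obtain e w where e: "\<And>N. e N \<in> G" "\<And>N. e N \<noteq> {}" "\<And>N. N < Min (e N)"
    and w: "\<And>N. block (subseq_list x' (e N)) (w N)"
    by metis
  \<comment> \<open>the next set begins after the maximum of the previous one\<close>
  define N where "N = rec_nat 0 (\<lambda>_ M. Max (e M))"
  have N: "N 0 = 0" "N (Suc k) = Max (e (N k))" for k by (simp_all add: N_def)
  have fin: "finite (e M)" for M using e(1) finG by blast
  have MinMax: "Min (e M) \<le> Max (e M)" for M using fin e(2) by (intro Max_ge Min_in)
  have step: "N k < N (Suc k)" for k using e(3)[of "N k"] MinMax[of "N k"] by (simp add: N)
  then have smN: "strict_mono N" by (simp add: strict_mono_Suc_iff)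
  have less: "Max (e (N i)) < Min (e (N j))" if "i < j" for i j
  proof -
    have "Max (e (N i)) = N (Suc i)" by (simp add: N)
    also have "\<dots> \<le> N j" using smN that by (simp add: strict_mono_less_eq)
    also have "\<dots> < Min (e (N j))" by (rule e(3))
    finally show ?thesis .
  qed
  have "subseq_list (w \<circ> N) E \<in> B" if E: "E \<in> F" for E
  proof -
    have finE: "finite E" using finF E by blast
    have "(\<lambda>k. Min (e (N k))) ` E \<in> F"
    proof (rule spreadingD[OF spF E])
      show "strict_mono_on E (\<lambda>k. Min (e (N k)))"
        using less MinMax by (intro strict_mono_onI) (meson order_le_less_trans)
      show "k \<le> Min (e (N k))" for k
        using strict_mono_imp_increasing[OF smN, of k] e(3)[of "N k"] by simp
    qed
    then have "(\<Union>k\<in>E. e (N k)) \<in> family_comp F G"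
      using e less finE by (intro family_compI) auto
    then have "subseq_list x' (\<Union>k\<in>E. e (N k)) \<in> T" by (rule x')
    also have "subseq_list x' (\<Union>k\<in>E. e (N k)) =
        concat (map (\<lambda>k. subseq_list x' (e (N k))) (sorted_list_of_set E))"
    proof (rule subseq_list_UN[OF finE fin])
      fix i j a b assume "i < j" "a \<in> e (N i)" "b \<in> e (N j)"
      then show "a < b"
        using less[of i j] Max_ge[OF fin, of a "N i"] Min_le[OF fin, of b "N j"] by simp
    qed
    finally show ?thesis
      unfolding subseq_list_def
      by (rule blocks_in) (simp add: list_all2_conv_all_nth w[unfolded subseq_list_def])
  qed
  then show ?thesis by blast
qed

text \<open>
  An index counts only up to \<open>\<omega>\<^sub>1\<close>, so the sum is cut off there; the family of order \<open>\<omega>\<^sub>1\<close> contains all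
  finite sets of positive integers and hence every composition, without passing to a subsequence.
\<close>

lemma least_upto_omega1_subadditive:
  assumes q: "schreier_choice q" and "[] \<in> A"
  defines "I \<equiv> \<lambda>S. least_upto_omega1 (\<lambda>\<xi>. \<not> (\<exists>x. \<forall>E\<in>schreier q \<xi>. subseq_list x E \<in> S))"
  shows "I T \<le> I A + I B"
proof -
  define no where "no = (\<lambda>(S :: 'a list set) \<xi>. \<not> (\<exists>x. \<forall>E\<in>schreier q \<xi>. subseq_list x E \<in> S))"
  have I: "I S = least_upto_omega1 (no S)" for S by (simp add: I_def no_def)
  show ?thesis
  proof (cases "(\<exists>\<xi>\<le>omega1. no A \<xi>) \<and> (\<exists>\<xi>\<le>omega1. no B \<xi>)")
    case True
    define \<alpha> where "\<alpha> = (LEAST \<xi>. \<xi> \<le> omega1 \<and> no A \<xi>)"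
    define \<beta> where "\<beta> = (LEAST \<xi>. \<xi> \<le> omega1 \<and> no B \<xi>)"
    have "\<alpha> \<le> omega1 \<and> no A \<alpha>" unfolding \<alpha>_def by (rule LeastI_ex) (rule True[THEN conjunct1])
    moreover have "\<beta> \<le> omega1 \<and> no B \<beta>" unfolding \<beta>_def by (rule LeastI_ex) (rule True[THEN conjunct2])
    ultimately have no: "no A \<alpha>" "no B \<beta>" by auto
    define \<gamma> where "\<gamma> = min (oadd \<alpha> \<beta>) omega1"
    obtain g where g: "strict_mono g"
      "\<And>U. U \<in> family_comp (schreier q \<beta>) (schreier q \<alpha>) \<Longrightarrow> g ` U \<in> schreier q \<gamma>"
    proof (cases "oadd \<alpha> \<beta> < omega1")
      case True
      then show ?thesis using schreier_comp_into_oadd[OF q True] that by (auto simp: \<gamma>_def)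
    next
      case False
      then have "\<gamma> = omega1" by (simp add: \<gamma>_def)
      moreover have "finite U \<and> 0 \<notin> U" if "U \<in> family_comp (schreier q \<beta>) (schreier q \<alpha>)" for U
        using that schreier_finite by (rule family_comp_finite)
      ultimately show ?thesis by (intro that[of id]) (auto simp: strict_mono_def schreier_omega1)
    qed
    have "no T \<gamma>"
    proof (rule ccontr)
      assume "\<not> no T \<gamma>"
      then obtain x where x: "\<And>E. E \<in> schreier q \<gamma> \<Longrightarrow> subseq_list x E \<in> T"
        by (auto simp: no_def)
      have "\<exists>y. \<forall>E\<in>schreier q \<beta>. subseq_list y E \<in> B"
      proof (rule block_sequence[where F = "schreier q \<beta>" and G = "schreier q \<alpha>" and H = "schreier q \<gamma>"])
        show "\<not> (\<exists>x'. \<forall>E\<in>schreier q \<alpha>. subseq_list x' E \<in> A)" using no(1) by (simp add: no_def)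
      qed (use spreading_schreier schreier_finite singleton_in_schreier[OF q] g x assms(2) in blast)+
      then show False using no(2) unfolding no_def by blast
    qed
    moreover have "\<gamma> \<le> omega1" by (simp add: \<gamma>_def)
    ultimately have "(\<exists>\<xi>\<le>omega1. no T \<xi>) \<and> (LEAST \<xi>. \<xi> \<le> omega1 \<and> no T \<xi>) \<le> \<gamma>"
      by (auto intro: Least_le)
    then have "I T \<le> Ord \<gamma>" by (simp add: I least_upto_omega1_def)
    also have "\<dots> \<le> Ord (oadd \<alpha> \<beta>)" by (simp add: \<gamma>_def)
    also have "\<dots> = I A + I B" using True by (simp add: I least_upto_omega1_def \<alpha>_def \<beta>_def)
    finally show ?thesis .
  next
    case False
    then have "I A + I B = Infty"
      unfolding I least_upto_omega1_def by (cases "\<exists>\<xi>\<le>omega1. no A \<xi>") auto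
    then show ?thesis by simp
  qed
qed

end

section \<open>Linear combinations of blocks\<close>

text \<open>
  Coefficients are kept in lists, like the vectors, because concatenation of blocks is awkward for
  coefficients indexed by numbers.
\<close>

definition lincomb :: "('k \<Rightarrow> 'a \<Rightarrow> 'a::ab_group_add) \<Rightarrow> 'k list \<Rightarrow> 'a list \<Rightarrow> 'a" where
  "lincomb smul as xs = sum_list (map2 smul as xs)"

lemma lincomb_simps [simp]:
  "lincomb smul [] xs = 0" "lincomb smul as [] = 0"
  "lincomb smul (a # as) (x # xs) = smul a x + lincomb smul as xs"
  by (simp_all add: lincomb_def)

lemma lincomb_append:
  "length as = length xs \<Longrightarrow>
    lincomb smul (as @ bs) (xs @ ys) = lincomb smul as xs + lincomb smul bs ys"
  by (simp add: lincomb_def)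

lemma lincomb_eq_sum:
  "length as = length xs \<Longrightarrow> lincomb smul as xs = (\<Sum>i<length xs. smul (as ! i) (xs ! i))"
  by (simp add: lincomb_def sum_list_sum_nth atLeast0LessThan)

lemma sum_list_map_eq_sum_length:
  "length as = n \<Longrightarrow> sum_list (map f as) = (\<Sum>i<n. f (as ! i))"
  by (auto simp: sum_list_sum_nth atLeast0LessThan)

lemma in_T1_iff:
  fixes smul :: "'k::real_normed_field \<Rightarrow> 'a::banach \<Rightarrow> 'a"
  shows
  "xs \<in> T1 smul K \<longleftrightarrow> (\<forall>x\<in>set xs. norm x \<le> 1) \<and>
    (\<forall>as. length as = length xs \<and> sum_list (map norm as) = 1 \<longrightarrow>
      inverse K \<le> norm (lincomb smul as xs) \<and> norm (lincomb smul as xs) \<le> 1)"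
proof -
  let ?n = "length xs"
  let ?C = "\<lambda>v. inverse K \<le> norm v \<and> norm v \<le> 1"
  have "(\<forall>a. (\<Sum>i<?n. norm (a i)) = 1 \<longrightarrow> ?C (\<Sum>i<?n. smul (a i) (xs ! i))) \<longleftrightarrow>
    (\<forall>as. length as = ?n \<and> sum_list (map norm as) = 1 \<longrightarrow> ?C (lincomb smul as xs))"
    (is "?L \<longleftrightarrow> ?R")
  proof
    assume ?L
    show ?R
    proof (intro allI impI, elim conjE)
      fix as :: "'k list" assume "length as = ?n" "sum_list (map norm as) = 1"
      then show "?C (lincomb smul as xs)"
        using \<open>?L\<close>[rule_format, of "\<lambda>i. as ! i"]
        by (simp add: lincomb_eq_sum sum_list_map_eq_sum_length)
    qed
  next
    assume ?R
    show ?L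
    proof (intro allI impI)
      fix a :: "nat \<Rightarrow> 'k" assume "(\<Sum>i<?n. norm (a i)) = 1"
      then show "?C (\<Sum>i<?n. smul (a i) (xs ! i))"
        using \<open>?R\<close>[rule_format, of "map a [0..<?n]"]
        by (simp add: lincomb_eq_sum sum_list_map_eq_sum_length del: map_map)
    qed
  qed
  then show ?thesis unfolding T1_def by simp
qed

lemma in_W_iff:
  fixes smul :: "'k::real_normed_field \<Rightarrow> 'a::banach \<Rightarrow> 'a"
  shows
  "xs \<in> W smul K \<longleftrightarrow> (\<forall>x\<in>set xs. 1 \<le> norm x) \<and>
    (\<forall>as. length as = length xs \<and> (\<forall>a\<in>set as. norm a \<le> 1) \<and> (\<exists>a\<in>set as. norm a = 1) \<longrightarrow>
      norm (lincomb smul as xs) \<le> K)"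
proof -
  let ?n = "length xs"
  have "(\<forall>a. (\<forall>i<?n. norm (a i) \<le> 1) \<and> (\<exists>i<?n. norm (a i) = 1) \<longrightarrow>
      norm (\<Sum>i<?n. smul (a i) (xs ! i)) \<le> K) \<longleftrightarrow>
    (\<forall>as. length as = ?n \<and> (\<forall>a\<in>set as. norm a \<le> 1) \<and> (\<exists>a\<in>set as. norm a = 1) \<longrightarrow>
      norm (lincomb smul as xs) \<le> K)"
    (is "?L \<longleftrightarrow> ?R")
  proof
    assume ?L
    show ?R
    proof (intro allI impI, elim conjE)
      fix as :: "'k list"
      assume len: "length as = ?n" and as: "\<forall>a\<in>set as. norm a \<le> 1" "\<exists>a\<in>set as. norm a = 1"
      have "\<forall>i<?n. norm (as ! i) \<le> 1" "\<exists>i<?n. norm (as ! i) = 1"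
        using as nth_mem[of _ as] len by (auto simp: in_set_conv_nth)
      then show "norm (lincomb smul as xs) \<le> K"
        using spec[OF \<open>?L\<close>, of "\<lambda>i. as ! i"] len by (simp add: lincomb_eq_sum)
    qed
  next
    assume ?R
    show ?L
    proof (intro allI impI, elim conjE)
      fix a :: "nat \<Rightarrow> 'k" assume "\<forall>i<?n. norm (a i) \<le> 1" "\<exists>i<?n. norm (a i) = 1"
      then show "norm (\<Sum>i<?n. smul (a i) (xs ! i)) \<le> K"
        using spec[OF \<open>?R\<close>, of "map a [0..<?n]"] by (fastforce simp: lincomb_eq_sum)
    qed
  qed
  then show ?thesis unfolding W_def by simp
qed

text \<open>
  The coefficients obtained when a combination with coefficients \<open>bs\<close> of combinations with coefficients
  \<open>ass\<close> is expanded.  Both the \<open>\<ell>\<^sub>1\<close> sphere and the \<open>\<ell>\<^sub>\<infinity>\<close> sphere are stable under this operation.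
\<close>

definition scaled_concat :: "'k::times list \<Rightarrow> 'k list list \<Rightarrow> 'k list" where
  "scaled_concat bs ass = concat (map2 (\<lambda>b. map ((*) b)) bs ass)"

lemma scaled_concat_simps [simp]:
  "scaled_concat [] ass = []" "scaled_concat (b # bs) (as # ass) = map ((*) b) as @ scaled_concat bs ass"
  by (simp_all add: scaled_concat_def)

lemma sum_list_norm_scaled_concat:
  fixes bs :: "'k::real_normed_field list"
  assumes "length bs = length ass" and "\<forall>as\<in>set ass. sum_list (map norm as) = 1"
  shows "sum_list (map norm (scaled_concat bs ass)) = sum_list (map norm bs)"
  using assms
proof (induction bs ass rule: list_induct2)
  case (Cons b bs as ass)
  have "sum_list (map norm (map ((*) b) as)) = norm b * sum_list (map norm as)"
    by (simp add: norm_mult sum_list_const_mult comp_def)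
  then show ?case using Cons by simp
qed simp

lemma norm_scaled_concat_le_1:
  fixes bs :: "'k::real_normed_field list"
  assumes "length bs = length ass" and "\<forall>as\<in>set ass. \<forall>a\<in>set as. norm a \<le> 1"
    and "\<forall>b\<in>set bs. norm b \<le> 1"
  shows "\<forall>c\<in>set (scaled_concat bs ass). norm c \<le> 1"
  using assms by (induction bs ass rule: list_induct2) (auto simp: norm_mult mult_le_one)

lemma norm_scaled_concat_eq_1:
  fixes bs :: "'k::real_normed_field list"
  assumes "length bs = length ass" and "\<forall>as\<in>set ass. \<exists>a\<in>set as. norm a = 1"
    and "\<exists>b\<in>set bs. norm b = 1"
  shows "\<exists>c\<in>set (scaled_concat bs ass). norm c = 1"
  using assms
proof (induction bs ass rule: list_induct2)
  case (Cons b bs as ass)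
  obtain a where "a \<in> set as" "norm a = 1" using Cons.prems(1) by auto
  then have "\<exists>c\<in>set (map ((*) b) as). norm c = 1" if "norm b = 1"
    using that by (auto simp: norm_mult)
  then show ?case using Cons by (auto simp: bex_Un)
qed simp

context banach_space
begin

lemma lincomb_map_mult: "lincomb smul (map ((*) c) as) xs = smul c (lincomb smul as xs)"
proof (induction as arbitrary: xs)
  case (Cons a as)
  then show ?case by (cases xs) (simp_all add: scale_right_distrib)
qed simp

lemma lincomb_zeros: "lincomb smul (replicate n 0) xs = 0"
proof (induction n arbitrary: xs)
  case (Suc n)
  then show ?case by (cases xs) simp_all
qed simp

lemma lincomb_in_span: "lincomb smul as xs \<in> span (set xs)"
proof (induction as arbitrary: xs)
  case (Cons a as)
  show ?case
  proof (cases xs)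
    case (Cons x xs')
    have "lincomb smul as xs' \<in> span (set xs)"
      using \<open>\<And>xs. lincomb smul as xs \<in> span (set xs)\<close>[of xs'] span_mono[of "set xs'" "set xs"] Cons by auto
    then show ?thesis using Cons by (simp add: span_add span_scale span_base)
  qed (simp add: span_zero)
qed (simp add: span_zero)

lemma norm_lincomb_le:
  "\<forall>x\<in>set xs. norm x \<le> 1 \<Longrightarrow> norm (lincomb smul as xs) \<le> sum_list (map norm as)"
proof (induction as arbitrary: xs)
  case (Cons a as)
  show ?case
  proof (cases xs)
    case Nil
    then show ?thesis by (auto intro!: add_nonneg_nonneg sum_list_nonneg)
  next
    case x: (Cons x xs')
    have "norm (smul a x) \<le> norm a" using Cons.prems x by (simp add: norm_smul mult_left_le)
    moreover have "norm (lincomb smul as xs') \<le> sum_list (map norm as)" using Cons x by simp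
    ultimately show ?thesis
      using x norm_triangle_ineq[of "smul a x" "lincomb smul as xs'"] by simp
  qed
qed simp

definition scaled_block :: "('k list \<Rightarrow> bool) \<Rightarrow> 'k \<Rightarrow> 'a list \<Rightarrow> 'a \<Rightarrow> bool" where
  "scaled_block Q t u z \<longleftrightarrow>
     (\<exists>as. length as = length u \<and> Q as \<and> z = smul t (lincomb smul as u))"

lemma scaled_block_in_span: "scaled_block Q t u z \<Longrightarrow> z \<in> span (set u)"
  unfolding scaled_block_def by (auto intro: span_scale lincomb_in_span)

lemma lincomb_scaled_blocks:
  assumes "list_all2 (scaled_block Q t) us ys" and "length bs = length ys"
  obtains ass where "length bs = length ass" "\<forall>as\<in>set ass. Q as"
    "length (scaled_concat bs ass) = length (concat us)"
    "lincomb smul bs ys = smul t (lincomb smul (scaled_concat bs ass) (concat us))"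
proof -
  have "\<exists>ass. length bs = length ass \<and> (\<forall>as\<in>set ass. Q as) \<and>
    length (scaled_concat bs ass) = length (concat us) \<and>
    lincomb smul bs ys = smul t (lincomb smul (scaled_concat bs ass) (concat us))"
    using assms
  proof (induction us ys arbitrary: bs rule: list_all2_induct)
    case (Cons u us y ys)
    obtain as where as: "length as = length u" "Q as" "y = smul t (lincomb smul as u)"
      using Cons.hyps(1) by (auto simp: scaled_block_def)
    obtain b bs' where bs: "bs = b # bs'" "length bs' = length ys"
      using Cons.prems by (cases bs) auto
    obtain ass where ass: "length bs' = length ass" "\<forall>as\<in>set ass. Q as"
      "length (scaled_concat bs' ass) = length (concat us)"
      "lincomb smul bs' ys = smul t (lincomb smul (scaled_concat bs' ass) (concat us))"
      using Cons.IH[OF bs(2)] by blast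
    have "smul b y = smul t (lincomb smul (map ((*) b) as) u)"
      unfolding as(3) lincomb_map_mult scale_scale by (simp only: mult.commute)
    then have "lincomb smul bs (y # ys) =
        smul t (lincomb smul (scaled_concat bs (as # ass)) (concat (u # us)))"
      using as(1) ass(4) by (simp add: bs(1) lincomb_append scale_right_distrib)
    then show ?case using as ass bs(1) by (intro exI[of _ "as # ass"]) simp
  qed simp
  then show ?thesis using that by blast
qed

lemma T1_append:
  assumes "xs @ ys \<in> T1 smul K"
  shows "xs \<in> T1 smul K" "ys \<in> T1 smul K"
proof -
  have norm: "\<forall>x\<in>set (xs @ ys). norm x \<le> 1"
    and comb: "\<And>as. length as = length (xs @ ys) \<Longrightarrow> sum_list (map norm as) = 1 \<Longrightarrow>
      inverse K \<le> norm (lincomb smul as (xs @ ys)) \<and> norm (lincomb smul as (xs @ ys)) \<le> 1"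
    using assms by (simp_all add: in_T1_iff)
  have "inverse K \<le> norm (lincomb smul as xs) \<and> norm (lincomb smul as xs) \<le> 1"
    if "length as = length xs" "sum_list (map norm as) = 1" for as
    using comb[of "as @ replicate (length ys) 0"] that
    by (simp add: lincomb_append lincomb_zeros sum_list_replicate)
  then show "xs \<in> T1 smul K" using norm by (simp add: in_T1_iff)
  have "inverse K \<le> norm (lincomb smul as ys) \<and> norm (lincomb smul as ys) \<le> 1"
    if "length as = length ys" "sum_list (map norm as) = 1" for as
    using comb[of "replicate (length xs) 0 @ as"] that
    by (simp add: lincomb_append lincomb_zeros sum_list_replicate)
  then show "ys \<in> T1 smul K" using norm by (simp add: in_T1_iff)
qed

lemma W_append:
  assumes "xs @ ys \<in> W smul K"
  shows "xs \<in> W smul K" "ys \<in> W smul K"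
proof -
  have norm: "\<forall>x\<in>set (xs @ ys). 1 \<le> norm x"
    and comb: "\<And>as. length as = length (xs @ ys) \<Longrightarrow> \<forall>a\<in>set as. norm a \<le> 1 \<Longrightarrow>
      \<exists>a\<in>set as. norm a = 1 \<Longrightarrow> norm (lincomb smul as (xs @ ys)) \<le> K"
    using assms by (simp_all add: in_W_iff)
  have "norm (lincomb smul as xs) \<le> K"
    if "length as = length xs" "\<forall>a\<in>set as. norm a \<le> 1" "\<exists>a\<in>set as. norm a = 1" for as
    using comb[of "as @ replicate (length ys) 0"] that
    by (simp add: lincomb_append lincomb_zeros ball_Un bex_Un)
  then show "xs \<in> W smul K" using norm by (simp add: in_W_iff)
  have "norm (lincomb smul as ys) \<le> K"
    if "length as = length ys" "\<forall>a\<in>set as. norm a \<le> 1" "\<exists>a\<in>set as. norm a = 1" for as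
    using comb[of "replicate (length xs) 0 @ as"] that
    by (simp add: lincomb_append lincomb_zeros ball_Un bex_Un)
  then show "ys \<in> W smul K" using norm by (simp add: in_W_iff)
qed

lemma Nil_in_T1: "[] \<in> T1 smul K"
  by (simp add: in_T1_iff)

lemma Nil_in_W: "[] \<in> W smul K"
  by (simp add: in_W_iff)

lemma nonzero_T1:
  assumes "0 < K" and "xs \<in> T1 smul K" and "x \<in> set xs"
  shows "x \<noteq> 0"
proof -
  obtain ys zs where "xs = ys @ [x] @ zs" using assms(3) by (auto dest: split_list)
  then have "[x] \<in> T1 smul K" using assms(2) T1_append by blast
  then have "inverse K \<le> norm (lincomb smul [1] [x])"
    unfolding in_T1_iff by (elim conjE allE[of _ "[1]"]) simp
  then show ?thesis using assms(1) by auto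
qed

lemma nonzero_W: "xs \<in> W smul K \<Longrightarrow> x \<in> set xs \<Longrightarrow> x \<noteq> 0"
  by (auto simp: in_W_iff)

text \<open>
  A combination of norm below \<open>1/C\<close>, which shows that \<open>u\<close> is bad for the constant \<open>C\<close>, stays in the unit
  ball when it is multiplied by \<open>C\<close>.
\<close>

definition T1_block :: "real \<Rightarrow> 'a list \<Rightarrow> 'a \<Rightarrow> bool" where
  "T1_block C u z \<longleftrightarrow> norm z \<le> 1 \<and>
     scaled_block (\<lambda>as. sum_list (map norm as) = 1) (of_real C) u z"

text \<open>
  Dually, a bad \<open>u\<close> has a combination of norm above \<open>C\<close>, and division by \<open>C\<close> leaves a vector of norm at
  least one.
\<close>

definition W_block :: "real \<Rightarrow> 'a list \<Rightarrow> 'a \<Rightarrow> bool" where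
  "W_block C u z \<longleftrightarrow> 1 \<le> norm z \<and>
     scaled_block (\<lambda>as. (\<forall>a\<in>set as. norm a \<le> 1) \<and> (\<exists>a\<in>set as. norm a = 1))
       (of_real (inverse C)) u z"

text \<open>
  The multiplication by \<open>C\<close> raises the lower estimate \<open>1/(C K)\<close> to \<open>1/K\<close>, while the upper estimate
  follows from the triangle inequality.
\<close>

lemma blocking_T1:
  assumes "0 < C" and "0 < K"
  shows "blocking (T1 smul (C * K)) (T1 smul C) (T1 smul K) (T1_block C)"
proof
  fix us ys assume T: "concat us \<in> T1 smul (C * K)" and "list_all2 (T1_block C) us ys"
  then have norm: "\<forall>y\<in>set ys. norm y \<le> 1"
    and blocks: "list_all2 (scaled_block (\<lambda>as. sum_list (map norm as) = 1) (of_real C)) us ys"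
    by (auto simp: T1_block_def list_all2_conv_all_nth in_set_conv_nth)
  show "ys \<in> T1 smul K"
    unfolding in_T1_iff
  proof (intro conjI norm allI impI; elim conjE)
    fix bs :: "'k list" assume bs: "length bs = length ys" "sum_list (map norm bs) = 1"
    show "norm (lincomb smul bs ys) \<le> 1" using norm_lincomb_le[OF norm, of bs] bs(2) by simp
    obtain ass where ass: "length bs = length ass" "\<forall>as\<in>set ass. sum_list (map norm as) = 1"
      "length (scaled_concat bs ass) = length (concat us)"
      "lincomb smul bs ys = smul (of_real C) (lincomb smul (scaled_concat bs ass) (concat us))"
      using lincomb_scaled_blocks[OF blocks bs(1)] .
    have "sum_list (map norm (scaled_concat bs ass)) = 1"
      using sum_list_norm_scaled_concat[OF ass(1,2)] bs(2) by simp
    then have "inverse (C * K) \<le> norm (lincomb smul (scaled_concat bs ass) (concat us))"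
      using T ass(3) unfolding in_T1_iff by blast
    then have "C * inverse (C * K) \<le> norm (lincomb smul bs ys)"
      using assms(1) by (simp add: ass(4) norm_smul)
    then show "inverse K \<le> norm (lincomb smul bs ys)" using assms by (simp add: field_simps)
  qed
next
  fix u assume u: "u \<in> T1 smul (C * K)" "u \<notin> T1 smul C"
  then obtain as where as: "length as = length u" "sum_list (map norm as) = 1"
    "norm (lincomb smul as u) < inverse C"
    unfolding in_T1_iff by (meson not_le)
  then have "norm (smul (of_real C) (lincomb smul as u)) \<le> 1"
    using assms(1) by (simp add: norm_smul field_simps)
  then show "\<exists>z. T1_block C u z" using as unfolding T1_block_def scaled_block_def by blast
next
  fix s u assume "s @ u \<in> T1 smul (C * K)"
  then show "u \<in> T1 smul (C * K)" by (rule T1_append)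
qed

lemma blocking_W:
  assumes "0 < C" and "0 < K"
  shows "blocking (W smul (C * K)) (W smul C) (W smul K) (W_block C)"
proof
  let ?Q = "\<lambda>as :: 'k list. (\<forall>a\<in>set as. norm a \<le> 1) \<and> (\<exists>a\<in>set as. norm a = 1)"
  fix us ys assume T: "concat us \<in> W smul (C * K)" and "list_all2 (W_block C) us ys"
  then have norm: "\<forall>y\<in>set ys. 1 \<le> norm y"
    and blocks: "list_all2 (scaled_block ?Q (of_real (inverse C))) us ys"
    by (auto simp: W_block_def list_all2_conv_all_nth in_set_conv_nth)
  show "ys \<in> W smul K"
    unfolding in_W_iff
  proof (intro conjI norm allI impI; elim conjE)
    fix bs :: "'k list"
    assume bs: "length bs = length ys" "\<forall>b\<in>set bs. norm b \<le> 1" "\<exists>b\<in>set bs. norm b = 1"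
    obtain ass where ass: "length bs = length ass" "\<forall>as\<in>set ass. ?Q as"
      "length (scaled_concat bs ass) = length (concat us)"
      "lincomb smul bs ys = smul (of_real (inverse C)) (lincomb smul (scaled_concat bs ass) (concat us))"
      using lincomb_scaled_blocks[OF blocks bs(1)] .
    have "\<forall>c\<in>set (scaled_concat bs ass). norm c \<le> 1"
      using ass(1,2) bs(2) by (intro norm_scaled_concat_le_1) auto
    moreover have "\<exists>c\<in>set (scaled_concat bs ass). norm c = 1"
      using ass(1,2) bs(3) by (intro norm_scaled_concat_eq_1) auto
    ultimately have "norm (lincomb smul (scaled_concat bs ass) (concat us)) \<le> C * K"
      using T ass(3) unfolding in_W_iff by blast
    then show "norm (lincomb smul bs ys) \<le> K"
      unfolding ass(4) norm_smul norm_of_real using assms(1) by (simp add: field_simps)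
  qed
next
  fix u assume u: "u \<in> W smul (C * K)" "u \<notin> W smul C"
  then obtain as where as: "length as = length u" "\<forall>a\<in>set as. norm a \<le> 1"
    "\<exists>a\<in>set as. norm a = 1" "C < norm (lincomb smul as u)"
    unfolding in_W_iff by (meson not_le)
  then have "1 \<le> norm (smul (of_real (inverse C)) (lincomb smul as u))"
    unfolding norm_smul norm_of_real using assms(1) by (simp add: field_simps)
  then show "\<exists>z. W_block C u z" using as unfolding W_block_def scaled_block_def by blast
next
  fix s u assume "s @ u \<in> W smul (C * K)"
  then show "u \<in> W smul (C * K)" by (rule W_append)
qed

lemma T1_block_in_span: "T1_block C u z \<Longrightarrow> z \<in> span (set u)"
  unfolding T1_block_def by (blast intro: scaled_block_in_span)

lemma W_block_in_span: "W_block C u z \<Longrightarrow> z \<in> span (set u)"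
  unfolding W_block_def by (blast intro: scaled_block_in_span)

end

section \<open>Supports with respect to a decomposition\<close>

locale banach_fdd = banach_space smul
  for smul :: "'k::real_normed_field \<Rightarrow> 'a::banach \<Rightarrow> 'a" +
  fixes E :: "nat \<Rightarrow> 'a set"
  assumes fdd: "is_fdd smul E"
begin

lemma fdd_proj_eq:
  assumes "\<And>n. f n \<in> E n" and "f sums x"
  shows "fdd_proj E n x = f n"
proof -
  have "\<exists>!f. (\<forall>n. f n \<in> E n) \<and> f sums x" using fdd unfolding is_fdd_def by blast
  then have "(THE f. (\<forall>n. f n \<in> E n) \<and> f sums x) = f" using assms by (intro the1_equality) auto
  then show ?thesis by (simp add: fdd_proj_def)
qed

lemma fdd_expansion: "(\<forall>n. fdd_proj E n x \<in> E n) \<and> (\<lambda>n. fdd_proj E n x) sums x"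
proof -
  obtain f where f: "\<And>n. f n \<in> E n" "f sums x" using fdd unfolding is_fdd_def by blast
  have "fdd_proj E n x = f n" for n by (rule fdd_proj_eq) (rule f)+
  then show ?thesis using f by simp
qed

lemma subspace_fdd: "subspace (E n)"
  using fdd unfolding is_fdd_def by blast

lemma fdd_proj_add: "fdd_proj E n (x + y) = fdd_proj E n x + fdd_proj E n y"
  using fdd_expansion
  by (intro fdd_proj_eq[of "\<lambda>n. fdd_proj E n x + fdd_proj E n y"])
    (auto intro: subspace_add subspace_fdd sums_add)

lemma fdd_proj_scale: "fdd_proj E n (smul c x) = smul c (fdd_proj E n x)"
proof (rule fdd_proj_eq)
  have "smul c (r *\<^sub>R x) = r *\<^sub>R smul c x" for r x
    unfolding smul_of_real[symmetric] scale_scale by (simp only: mult.commute)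
  then have "bounded_linear (smul c)"
    by (intro bounded_linear_intro[of _ "norm c"])
      (simp_all add: scale_right_distrib norm_smul mult.commute)
  then show "(\<lambda>n. smul c (fdd_proj E n x)) sums smul c x"
    using fdd_expansion[of x] by (intro bounded_linear.sums[of "smul c"]) simp_all
qed (use fdd_expansion in \<open>auto intro: subspace_scale subspace_fdd\<close>)

lemma fdd_supp_nonempty: "x \<noteq> 0 \<Longrightarrow> fdd_supp E x \<noteq> {}"
proof
  assume "x \<noteq> 0" and "fdd_supp E x = {}"
  then have "(\<lambda>n. fdd_proj E n x) = (\<lambda>_. 0)" by (auto simp: fdd_supp_def)
  then have "(\<lambda>_. 0) sums x" using fdd_expansion[of x] by simp
  then have "x = 0" by (rule sums_unique2) (rule sums_zero)
  with \<open>x \<noteq> 0\<close> show False by blast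
qed

lemma fdd_supp_span:
  assumes "z \<in> span S"
  shows "fdd_supp E z \<subseteq> (\<Union>x\<in>S. fdd_supp E x)"
proof -
  let ?V = "{z. fdd_supp E z \<subseteq> (\<Union>x\<in>S. fdd_supp E x)}"
  have "subspace ?V"
  proof (rule subspaceI)
    have "fdd_proj E n 0 = 0" for n using fdd_proj_scale[of n 0 0] by simp
    then show "0 \<in> ?V" by (simp add: fdd_supp_def)
  next
    fix x y assume "x \<in> ?V" "y \<in> ?V"
    moreover have "fdd_supp E (x + y) \<subseteq> fdd_supp E x \<union> fdd_supp E y"
      by (auto simp: fdd_supp_def fdd_proj_add)
    ultimately show "x + y \<in> ?V" by blast
  next
    fix c x assume "x \<in> ?V"
    moreover have "fdd_supp E (smul c x) \<subseteq> fdd_supp E x"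
      by (auto simp: fdd_supp_def fdd_proj_scale)
    ultimately show "smul c x \<in> ?V" by blast
  qed
  moreover have "S \<subseteq> ?V" by blast
  ultimately have "span S \<subseteq> ?V" by (rule span_minimal[rotated])
  then show ?thesis using assms by blast
qed

definition supp_before :: "'a \<Rightarrow> 'a \<Rightarrow> bool" where
  "supp_before x y \<longleftrightarrow> (\<forall>m\<in>fdd_supp E x. \<forall>n\<in>fdd_supp E y. m < n)"

text \<open>
  The condition on neighbours propagates to all pairs because non-zero vectors have non-empty
  supports, so that the minimum of each support is at most its maximum.
\<close>

lemma in_block_seqs_iff:
  "xs \<in> block_seqs E \<longleftrightarrow>
    (\<forall>x\<in>set xs. x \<noteq> 0 \<and> finite (fdd_supp E x)) \<and> sorted_wrt supp_before xs"
proof (cases "\<forall>x\<in>set xs. x \<noteq> 0 \<and> finite (fdd_supp E x)")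
  case True
  define R where "R = (\<lambda>x y. fdd_supp E x \<noteq> {} \<and> finite (fdd_supp E x) \<and>
    fdd_supp E y \<noteq> {} \<and> finite (fdd_supp E y) \<and> Max (fdd_supp E x) < Min (fdd_supp E y))"
  have "transp R"
  proof (rule transpI)
    fix x y z assume xy: "R x y" and yz: "R y z"
    then have "Min (fdd_supp E y) \<le> Max (fdd_supp E y)"
      unfolding R_def by (intro Max_ge Min_in) auto
    then show "R x z" using xy yz unfolding R_def by linarith
  qed
  have supp: "fdd_supp E x \<noteq> {}" "finite (fdd_supp E x)" if "x \<in> set xs" for x
    using True that fdd_supp_nonempty by blast+
  have R: "R x y \<longleftrightarrow> supp_before x y" if "x \<in> set xs" "y \<in> set xs" for x y
    using supp[OF that(1)] supp[OF that(2)] unfolding R_def supp_before_def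
    by (simp add: Max_less_iff Min_gr_iff) blast
  have "xs \<in> block_seqs E \<longleftrightarrow>
      (\<forall>i. Suc i < length xs \<longrightarrow> Max (fdd_supp E (xs ! i)) < Min (fdd_supp E (xs ! Suc i)))"
    using True by (simp add: block_seqs_def)
  also have "\<dots> \<longleftrightarrow> (\<forall>i. Suc i < length xs \<longrightarrow> R (xs ! i) (xs ! Suc i))"
    using supp unfolding R_def by (metis Suc_lessD nth_mem)
  also have "\<dots> \<longleftrightarrow> sorted_wrt R xs"
    using \<open>transp R\<close> by (simp add: sorted_wrt_iff_nth_Suc_transp)
  also have "\<dots> \<longleftrightarrow> sorted_wrt supp_before xs"
    unfolding sorted_wrt_iff_nth_less using R by (meson nth_mem order_less_trans)
  finally show ?thesis using True by simp
qed (auto simp: block_seqs_def)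

lemma block_seqs_append:
  assumes "xs @ ys \<in> block_seqs E"
  shows "xs \<in> block_seqs E" "ys \<in> block_seqs E"
  using assms by (auto simp: in_block_seqs_iff sorted_wrt_append)

lemma supp_before_span:
  assumes "\<forall>x\<in>S. \<forall>y\<in>S'. supp_before x y" and "z \<in> span S" and "z' \<in> span S'"
  shows "supp_before z z'"
  using assms(1) fdd_supp_span[OF assms(2)] fdd_supp_span[OF assms(3)]
  unfolding supp_before_def by blast

lemma block_seqs_blocks:
  assumes "concat us \<in> block_seqs E" and "list_all2 (\<lambda>u z. z \<in> span (set u)) us zs"
    and "\<forall>z\<in>set zs. z \<noteq> 0"
  shows "zs \<in> block_seqs E"
  using assms(2,1,3)
proof (induction us zs rule: list_all2_induct)
  case (Cons u us z zs)
  have conc: "\<forall>x\<in>set u. finite (fdd_supp E x)" "\<forall>x\<in>set u. \<forall>y\<in>set (concat us). supp_before x y"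
    using Cons.prems(1) by (auto simp: in_block_seqs_iff sorted_wrt_append)
  have "zs \<in> block_seqs E"
    using Cons.IH Cons.prems block_seqs_append(2)[of u "concat us"] by simp
  moreover have "finite (fdd_supp E z)"
    using finite_subset[OF fdd_supp_span[OF Cons.hyps(1)]] conc(1) by simp
  moreover have "supp_before z y" if y: "y \<in> set zs" for y
  proof -
    obtain u' where "u' \<in> set us" "y \<in> span (set u')"
      using Cons.hyps(2) y unfolding list_all2_conv_all_nth by (metis in_set_conv_nth)
    then have "y \<in> span (set (concat us))" using span_mono[of "set u'" "set (concat us)"] by auto
    then show ?thesis using supp_before_span[OF conc(2) Cons.hyps(1)] by blast
  qed
  ultimately show ?case using Cons.prems(2) by (simp add: in_block_seqs_iff)
qed (simp add: in_block_seqs_iff)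

lemma blocking_block_seqs:
  assumes "blocking T A B block" and span: "\<And>u z. block u z \<Longrightarrow> z \<in> span (set u)"
    and nonzero: "\<And>ys y. ys \<in> B \<Longrightarrow> y \<in> set ys \<Longrightarrow> y \<noteq> 0"
  shows "blocking (T \<inter> block_seqs E) (A \<inter> block_seqs E) (B \<inter> block_seqs E) block"
proof -
  interpret blocking T A B block by fact
  show ?thesis
  proof
    fix us ys assume us: "concat us \<in> T \<inter> block_seqs E" and blocks: "list_all2 block us ys"
    have ys: "ys \<in> B" using us blocks blocks_in by blast
    have "list_all2 (\<lambda>u z. z \<in> span (set u)) us ys" by (rule list_all2_mono[OF blocks span])
    then have "ys \<in> block_seqs E"
      using us nonzero[OF ys] block_seqs_blocks[of us ys] by simp
    with ys show "ys \<in> B \<inter> block_seqs E" by blast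
  next
    fix u assume "u \<in> T \<inter> block_seqs E" and "u \<notin> A \<inter> block_seqs E"
    then show "\<exists>z. block u z" by (intro block_exists) simp_all
  next
    fix s u assume "s @ u \<in> T \<inter> block_seqs E"
    then show "u \<in> T \<inter> block_seqs E" using suffix_closed[of s u] block_seqs_append(2)[of s u] by simp
  qed
qed

text \<open>
  A block of vectors that are supported beyond \<open>i\<close> is supported beyond \<open>i\<close>.  It must be non-zero for
  this, as the infimum of the empty support carries no information.
\<close>

lemma derivative_order_fdd_le:
  assumes "blocking T A B block" and span: "\<And>u z. block u z \<Longrightarrow> z \<in> span (set u)"
    and nonzero: "\<And>ys y. ys \<in> B \<Longrightarrow> y \<in> set ys \<Longrightarrow> y \<noteq> 0"
  shows "derivative_order (fdd_derivative E) (T \<inter> block_seqs E) \<le>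
    derivative_order (fdd_derivative E) (A \<inter> block_seqs E) *
    derivative_order (fdd_derivative E) (B \<inter> block_seqs E)"
proof -
  interpret blocking "T \<inter> block_seqs E" "A \<inter> block_seqs E" "B \<inter> block_seqs E" block
    using assms by (rule blocking_block_seqs)
  show ?thesis
    unfolding fdd_derivative_eq
  proof (rule derivative_order_le_times)
    fix i u z assume u: "u \<in> T \<inter> block_seqs E" and z: "block u z"
      and i: "\<forall>x\<in>set u. i \<le> Inf (fdd_supp E x)"
    have "[z] \<in> B \<inter> block_seqs E" using blocks_in[of "[u]" "[z]"] u z by simp
    then have "fdd_supp E z \<noteq> {}" using nonzero fdd_supp_nonempty by (metis IntD1 list.set_intros(1))
    then have "Inf (fdd_supp E z) \<in> fdd_supp E z" by (rule Inf_nat_def1)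
    then obtain x where "x \<in> set u" "Inf (fdd_supp E z) \<in> fdd_supp E x"
      using fdd_supp_span[OF span[OF z]] by blast
    then show "i \<le> Inf (fdd_supp E z)" using i cInf_lower[of _ "fdd_supp E x"] by fastforce
  qed simp
qed

end

lemma derivative_order_tree_le:
  assumes "blocking T A B block"
    and "\<And>xs ys. xs @ ys \<in> T \<Longrightarrow> xs \<in> T" "\<And>xs ys. xs @ ys \<in> A \<Longrightarrow> xs \<in> A" "\<And>xs ys. xs @ ys \<in> B \<Longrightarrow> xs \<in> B"
  shows "derivative_order tree_derivative T \<le>
    derivative_order tree_derivative A * derivative_order tree_derivative B"
proof -
  interpret blocking T A B block by fact
  have "derivative_order (branching_derivative (\<lambda>_ _. True)) T \<le>
    derivative_order (branching_derivative (\<lambda>_ _. True)) A *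
    derivative_order (branching_derivative (\<lambda>_ _. True)) B"
    by (rule derivative_order_le_times) simp_all
  then show ?thesis
    using derivative_order_tree_derivative_eq[OF assms(2)]
      derivative_order_tree_derivative_eq[OF assms(3)] derivative_order_tree_derivative_eq[OF assms(4)]
    by simp
qed

section \<open>Submultiplicativity and subadditivity\<close>

theorem theorem6p1:
  fixes smul :: "'k::real_normed_field \<Rightarrow> 'a::banach \<Rightarrow> 'a"
    and q :: "'a ordinal \<Rightarrow> nat \<Rightarrow> 'a ordinal"
  assumes "banach_space smul" and "schreier_choice q"
  shows "submultiplicative_index (I1 smul) \<and>
         (\<forall>E. is_fdd smul E \<longrightarrow> submultiplicative_index (I1_fdd smul E)) \<and>
         (\<forall>E. is_fdd smul E \<longrightarrow> submultiplicative_index (I1_asymp smul E)) \<and>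
         submultiplicative_index (J smul) \<and>
         (\<forall>E. is_fdd smul E \<longrightarrow> submultiplicative_index (J_fdd smul E)) \<and>
         (\<forall>E. is_fdd smul E \<longrightarrow> submultiplicative_index (J_asymp smul E)) \<and>
         subadditive_index (SM1 smul q) \<and>
         subadditive_index (SJ smul q)"
proof -
  interpret banach_space smul by fact
  have T1: "blocking (T1 smul (C * K)) (T1 smul C) (T1 smul K) (T1_block C)"
    and W: "blocking (W smul (C * K)) (W smul C) (W smul K) (W_block C)"
    if "1 \<le> C" "1 \<le> K" for C K
    using that by (auto intro: blocking_T1 blocking_W)
  have fdd: "submultiplicative_index (I1_fdd smul E)" "submultiplicative_index (I1_asymp smul E)"
    "submultiplicative_index (J_fdd smul E)" "submultiplicative_index (J_asymp smul E)"
    if "is_fdd smul E" for E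
  proof -
    interpret banach_fdd smul E using that by unfold_locales
    have T1E: "blocking (T1 smul (C * K) \<inter> block_seqs E) (T1 smul C \<inter> block_seqs E)
        (T1 smul K \<inter> block_seqs E) (T1_block C)" if "1 \<le> C" "1 \<le> K" for C K
    proof (rule blocking_block_seqs[OF T1[OF that]])
      fix ys y assume "ys \<in> T1 smul K" "y \<in> set ys"
      then show "y \<noteq> 0" using that(2) by (intro nonzero_T1[of K]) simp_all
    qed (rule T1_block_in_span)
    have WE: "blocking (W smul (C * K) \<inter> block_seqs E) (W smul C \<inter> block_seqs E)
        (W smul K \<inter> block_seqs E) (W_block C)" if "1 \<le> C" "1 \<le> K" for C K
      by (rule blocking_block_seqs[OF W[OF that]]) (erule W_block_in_span, erule (1) nonzero_W)
    show "submultiplicative_index (I1_fdd smul E)"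
      unfolding submultiplicative_index_def I1_fdd_def
      by (intro allI impI derivative_order_tree_le[OF T1E])
        (auto dest: T1_append(1) block_seqs_append(1))
    show "submultiplicative_index (J_fdd smul E)"
      unfolding submultiplicative_index_def J_fdd_def
      by (intro allI impI derivative_order_tree_le[OF WE])
        (auto dest: W_append(1) block_seqs_append(1))
    show "submultiplicative_index (I1_asymp smul E)"
      unfolding submultiplicative_index_def I1_asymp_def
    proof (intro allI impI)
      fix C K :: real assume "1 \<le> C" "1 \<le> K"
      then show "derivative_order (fdd_derivative E) (T1 smul (C * K) \<inter> block_seqs E) \<le>
          derivative_order (fdd_derivative E) (T1 smul C \<inter> block_seqs E) *
          derivative_order (fdd_derivative E) (T1 smul K \<inter> block_seqs E)"
      proof (rule derivative_order_fdd_le[OF T1])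
        fix ys y assume "ys \<in> T1 smul K" "y \<in> set ys"
        then show "y \<noteq> 0" using \<open>1 \<le> K\<close> by (intro nonzero_T1[of K]) simp_all
      qed (rule T1_block_in_span)
    qed
    show "submultiplicative_index (J_asymp smul E)"
      unfolding submultiplicative_index_def J_asymp_def
      by (intro allI impI, rule derivative_order_fdd_le[OF W])
        (assumption, assumption, erule W_block_in_span, erule (1) nonzero_W)
  qed
  have "submultiplicative_index (I1 smul)"
    unfolding submultiplicative_index_def I1_def
    by (intro allI impI derivative_order_tree_le[OF T1]) (auto dest: T1_append(1))
  moreover have "submultiplicative_index (J smul)"
    unfolding submultiplicative_index_def J_def
    by (intro allI impI derivative_order_tree_le[OF W]) (auto dest: W_append(1))
  moreover have "subadditive_index (SM1 smul q)"
    unfolding subadditive_index_def SM1_def l1_spreading_model_def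
    by (intro allI impI, rule blocking.least_upto_omega1_subadditive[OF T1 assms(2) Nil_in_T1])
  moreover have "subadditive_index (SJ smul q)"
    unfolding subadditive_index_def SJ_def c0_special_def
    by (intro allI impI, rule blocking.least_upto_omega1_subadditive[OF W assms(2) Nil_in_W])
  ultimately show ?thesis using fdd by blast
qed

end
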